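(* Let $g^{\mathrm{cv}}$ be the pushforward to $\Omega$ through $\Phi$ of the left-invariant metric $g^{H,\ell}$ on $H$. Then $\Phi^*g^{\mathrm{can}}=g^{H,\ell}$, and consequently $g^{\mathrm{cv}}=g^{\mathrm{can}}$. In particular, $\nabla^{\mathrm{cv}}g^{\mathrm{can}}=0$.
   Context: Let $V\subset \mathrm{Sym}(3,\mathbb{R})$ be the 5-dimensional space of matrices $x=\begin{pmatrix} x_1 & 0 & x_4 \\ 0 & x_2 & x_5 \\ x_4 & x_5 & x_3 \end{pmatrix}$, $x_i\in\mathbb{R}$, and $\Omega\subset V$ the open cone of positive definite matrices in $V$. Let $H$ be the Lie group of real lower triangular $3\times 3$ matrices with positive diagonal entries and zero $(2,1)$ entry, with Lie algebra $\mathfrak{h}$ the lower triangular $3\times3$ matrices with zero $(2,1)$ entry. The map $\Phi:H\to\Omega$, $\Phi(T)=TT^{\top}$, is a diffeomorphism. For $u\in V$ let $\underline{u}\in\mathfrak h$ be the unique element with $u=\underline u+\underline u^{\top}$; the clan product on $V$ is $u\Delta w=\underline u\,w+w\,\underline u^{\top}$, with left multiplications $L_u(w)=u\Delta w$. Define $Q_\Delta(u,v)=\mathrm{tr}(L_{u\Delta v})$ on $V$ and $Q_{\mathfrak h}(A,B)=Q_\Delta(A+A^{\top},B+B^{\top})$ on $\mathfrak h$. The left-invariant metric on $H$ is $g^{H,\ell}_T(U,W)=Q_{\mathfrak h}(T^{-1}U,T^{-1}W)$ for $T\in H$, $U,W\in T_TH$. The canonical Hessian metric on $\Omega$ is $$g^{\mathrm{can}}_x(u,v)=-\frac12\left(\frac{u_1v_1}{x_1^2}+\frac{u_2v_2}{x_2^2}\right)+2\,\mathrm{tr}(x^{-1}ux^{-1}v),$$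 the Hessian of $\log\varphi_\Omega$ with $\varphi_\Omega(x)=c\,x_1^{1/2}x_2^{1/2}(\det x)^{-2}$, $c>0$. For $A\in\mathfrak h$ let $E^\ell_A(T)=TA$; $\nabla^{H,\ell}$ is the unique left-invariant affine connection on $H$ with $\nabla^{H,\ell}_{E^\ell_A}E^\ell_B=0$ for all $A,B\in\mathfrak h$, and $\nabla^{\mathrm{cv}}:=\Phi_*\nabla^{H,\ell}$ is its pushforward to $\Omega$. *)

theory Defs
  imports "HOL-Analysis.Analysis"
begin

section \<open>Calculus on relatively open subsets of linear subspaces\<close>

text \<open>
  Throughout, \<open>E\<close> is a linear subspace of a Euclidean space and \<open>M \<subseteq> E\<close> is relatively open
  in \<open>E\<close>, regarded as a manifold all of whose tangent spaces are \<open>E\<close>.  The value at \<open>u \<in> E\<close> of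
  the differential of a map at \<open>x \<in> M\<close> is the derivative along the line through \<open>x\<close>.
\<close>

definition dir_deriv ::
  "('a::real_normed_vector \<Rightarrow> 'b::real_normed_vector) \<Rightarrow> 'a \<Rightarrow> 'a \<Rightarrow> 'b" where
  "dir_deriv f x u = vector_derivative (\<lambda>t. f (x + t *\<^sub>R u)) (at 0)"

text \<open>
  Frechet derivatives at points of \<open>M\<close> are taken within \<open>M\<close>; they are determined only on the
  directions \<open>u \<in> E\<close>, and only these enter the recursion.
\<close>

fun Ck_on ::
  "nat \<Rightarrow> 'a set \<Rightarrow> 'a set \<Rightarrow> ('a::real_normed_vector \<Rightarrow> 'b::real_normed_vector) \<Rightarrow> bool" where
  "Ck_on 0 M E f \<longleftrightarrow> continuous_on M f"
| "Ck_on (Suc k) M E f \<longleftrightarrow>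
     (\<exists>f'. (\<forall>x\<in>M. (f has_derivative f' x) (at x within M)) \<and>
           (\<forall>u\<in>E. Ck_on k M E (\<lambda>x. f' x u)))"

definition smooth_on ::
  "'a set \<Rightarrow> 'a set \<Rightarrow> ('a::real_normed_vector \<Rightarrow> 'b::real_normed_vector) \<Rightarrow> bool" where
  "smooth_on M E f \<longleftrightarrow> (\<forall>k. Ck_on k M E f)"

text \<open>
  Vector fields are extended by \<open>0\<close> outside \<open>M\<close>, so that two of them are equal as functions
  if and only if they agree on \<open>M\<close>.
\<close>

definition vector_field :: "'a set \<Rightarrow> 'a set \<Rightarrow> ('a::real_normed_vector \<Rightarrow> 'a) \<Rightarrow> bool" where
  "vector_field M E X \<longleftrightarrow>
     smooth_on M E X \<and> (\<forall>x\<in>M. X x \<in> E) \<and> (\<forall>x. x \<notin> M \<longrightarrow> X x = 0)"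

text \<open>
  The first clause only fixes the value of the operator on arguments that are not vector fields.
\<close>

definition affine_connection ::
  "'a set \<Rightarrow> 'a set \<Rightarrow> (('a::real_normed_vector \<Rightarrow> 'a) \<Rightarrow> ('a \<Rightarrow> 'a) \<Rightarrow> 'a \<Rightarrow> 'a) \<Rightarrow> bool" where
  "affine_connection M E nabla \<longleftrightarrow>
     (\<forall>X Y. \<not> (vector_field M E X \<and> vector_field M E Y) \<longrightarrow> nabla X Y = (\<lambda>_. 0)) \<and>
     (\<forall>X Y. vector_field M E X \<longrightarrow> vector_field M E Y \<longrightarrow> vector_field M E (nabla X Y)) \<and>
     (\<forall>X X' Y. vector_field M E X \<longrightarrow> vector_field M E X' \<longrightarrow> vector_field M E Y \<longrightarrow>
        nabla (\<lambda>x. X x + X' x) Y = (\<lambda>x. nabla X Y x + nabla X' Y x)) \<and>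
     (\<forall>f X Y. smooth_on M E (f :: 'a \<Rightarrow> real) \<longrightarrow> vector_field M E X \<longrightarrow> vector_field M E Y \<longrightarrow>
        nabla (\<lambda>x. f x *\<^sub>R X x) Y = (\<lambda>x. f x *\<^sub>R nabla X Y x)) \<and>
     (\<forall>X Y Y'. vector_field M E X \<longrightarrow> vector_field M E Y \<longrightarrow> vector_field M E Y' \<longrightarrow>
        nabla X (\<lambda>x. Y x + Y' x) = (\<lambda>x. nabla X Y x + nabla X Y' x)) \<and>
     (\<forall>f X Y. smooth_on M E (f :: 'a \<Rightarrow> real) \<longrightarrow> vector_field M E X \<longrightarrow> vector_field M E Y \<longrightarrow>
        nabla X (\<lambda>x. f x *\<^sub>R Y x) =
          (\<lambda>x. f x *\<^sub>R nabla X Y x + dir_deriv f x (X x) *\<^sub>R Y x))"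

text \<open>
  In the next five definitions \<open>F\<close> is a diffeomorphism from \<open>M\<close> onto \<open>N\<close>.  A metric is a function
  of a base point and two tangent vectors.
\<close>

definition push_field ::
  "'a set \<Rightarrow> 'b set \<Rightarrow> ('a::real_normed_vector \<Rightarrow> 'b::real_normed_vector) \<Rightarrow>
   ('a \<Rightarrow> 'a) \<Rightarrow> 'b \<Rightarrow> 'b" where
  "push_field M N F X =
     (\<lambda>y. if y \<in> N then dir_deriv F (inv_into M F y) (X (inv_into M F y)) else 0)"

definition pull_field ::
  "'a set \<Rightarrow> ('a::real_normed_vector \<Rightarrow> 'b::real_normed_vector) \<Rightarrow> ('b \<Rightarrow> 'b) \<Rightarrow> 'a \<Rightarrow> 'a" where
  "pull_field M F Y = (\<lambda>x. if x \<in> M then dir_deriv (inv_into M F) (F x) (Y (F x)) else 0)"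

definition push_connection ::
  "'a set \<Rightarrow> 'b set \<Rightarrow> ('a::real_normed_vector \<Rightarrow> 'b::real_normed_vector) \<Rightarrow>
   (('a \<Rightarrow> 'a) \<Rightarrow> ('a \<Rightarrow> 'a) \<Rightarrow> 'a \<Rightarrow> 'a) \<Rightarrow> (('b \<Rightarrow> 'b) \<Rightarrow> ('b \<Rightarrow> 'b) \<Rightarrow> 'b \<Rightarrow> 'b)" where
  "push_connection M N F nabla X Y =
     push_field M N F (nabla (pull_field M F X) (pull_field M F Y))"

definition pull_metric ::
  "('a::real_normed_vector \<Rightarrow> 'b::real_normed_vector) \<Rightarrow> ('b \<Rightarrow> 'b \<Rightarrow> 'b \<Rightarrow> real) \<Rightarrow>
   'a \<Rightarrow> 'a \<Rightarrow> 'a \<Rightarrow> real" where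
  "pull_metric F g x u v = g (F x) (dir_deriv F x u) (dir_deriv F x v)"

definition push_metric ::
  "'a set \<Rightarrow> ('a::real_normed_vector \<Rightarrow> 'b::real_normed_vector) \<Rightarrow>
   ('a \<Rightarrow> 'a \<Rightarrow> 'a \<Rightarrow> real) \<Rightarrow> 'b \<Rightarrow> 'b \<Rightarrow> 'b \<Rightarrow> real" where
  "push_metric M F g = pull_metric (inv_into M F) g"

text \<open>
  \<open>(nabla_X g)(Y, Z) = X (g (Y, Z)) - g (nabla_X Y, Z) - g (Y, nabla_X Z)\<close>
\<close>

definition cov_deriv_metric ::
  "(('a::real_normed_vector \<Rightarrow> 'a) \<Rightarrow> ('a \<Rightarrow> 'a) \<Rightarrow> 'a \<Rightarrow> 'a) \<Rightarrow> ('a \<Rightarrow> 'a \<Rightarrow> 'a \<Rightarrow> real) \<Rightarrow>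
   ('a \<Rightarrow> 'a) \<Rightarrow> ('a \<Rightarrow> 'a) \<Rightarrow> ('a \<Rightarrow> 'a) \<Rightarrow> 'a \<Rightarrow> real" where
  "cov_deriv_metric nabla g X Y Z x =
     dir_deriv (\<lambda>y. g y (Y y) (Z y)) x (X x)
     - g x (nabla X Y x) (Z x) - g x (Y x) (nabla X Z x)"

definition metric_parallel ::
  "'a set \<Rightarrow> 'a set \<Rightarrow> (('a::real_normed_vector \<Rightarrow> 'a) \<Rightarrow> ('a \<Rightarrow> 'a) \<Rightarrow> 'a \<Rightarrow> 'a) \<Rightarrow>
   ('a \<Rightarrow> 'a \<Rightarrow> 'a \<Rightarrow> real) \<Rightarrow> bool" where
  "metric_parallel M E nabla g \<longleftrightarrow>
     (\<forall>X Y Z. vector_field M E X \<longrightarrow> vector_field M E Y \<longrightarrow> vector_field M E Z \<longrightarrow>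
        (\<forall>x\<in>M. cov_deriv_metric nabla g X Y Z x = 0))"


section \<open>The cone, the group and the clan\<close>

definition symV :: "real^5 \<Rightarrow> real^3^3" where
  "symV x = vector [vector [x$1, 0,   x$4],
                    vector [0,   x$2, x$5],
                    vector [x$4, x$5, x$3]]"

definition V :: "(real^3^3) set" where
  "V = range symV"

definition Omega :: "(real^3^3) set" where
  "Omega = {x \<in> V. \<forall>w. w \<noteq> 0 \<longrightarrow> w \<bullet> (x *v w) > 0}"

text \<open>
  Triangularity is spelled out by entries: on the index type \<open>3\<close> the numeral \<open>3\<close> equals \<open>0\<close>,
  so its order is not the order of the row numbers 1, 2, 3.
\<close>

definition hLie :: "(real^3^3) set" where
  "hLie = {A. A$1$2 = 0 \<and> A$1$3 = 0 \<and> A$2$3 = 0 \<and> A$2$1 = 0}"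

definition H :: "(real^3^3) set" where
  "H = {T \<in> hLie. \<forall>i. T$i$i > 0}"

definition Phi :: "real^3^3 \<Rightarrow> real^3^3" where
  "Phi T = T ** transpose T"

definition lower :: "real^3^3 \<Rightarrow> real^3^3" where
  "lower u = (THE A. A \<in> hLie \<and> u = A + transpose A)"

definition clan :: "real^3^3 \<Rightarrow> real^3^3 \<Rightarrow> real^3^3" where
  "clan u w = lower u ** w + w ** transpose (lower u)"

definition trace_V :: "(real^3^3 \<Rightarrow> real^3^3) \<Rightarrow> real" where
  "trace_V L = trace (matrix (inv symV \<circ> L \<circ> symV))"

definition Q_clan :: "real^3^3 \<Rightarrow> real^3^3 \<Rightarrow> real" where
  "Q_clan u v = trace_V (clan (clan u v))"

definition Q_h :: "real^3^3 \<Rightarrow> real^3^3 \<Rightarrow> real" where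
  "Q_h A B = Q_clan (A + transpose A) (B + transpose B)"

definition g_H :: "real^3^3 \<Rightarrow> real^3^3 \<Rightarrow> real^3^3 \<Rightarrow> real" where
  "g_H T U W = Q_h (matrix_inv T ** U) (matrix_inv T ** W)"

text \<open>The Hessian of \<open>log (c x_1^(1/2) x_2^(1/2) (det x)^(-2))\<close>, with \<open>c > 0\<close>, written out.\<close>

definition g_can :: "real^3^3 \<Rightarrow> real^3^3 \<Rightarrow> real^3^3 \<Rightarrow> real" where
  "g_can x u v =
     - (1/2) * (u$1$1 * v$1$1 / (x$1$1)\<^sup>2 + u$2$2 * v$2$2 / (x$2$2)\<^sup>2)
     + 2 * trace (matrix_inv x ** u ** matrix_inv x ** v)"

definition g_cv :: "real^3^3 \<Rightarrow> real^3^3 \<Rightarrow> real^3^3 \<Rightarrow> real" where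
  "g_cv = push_metric H Phi g_H"

definition left_inv_field :: "real^3^3 \<Rightarrow> real^3^3 \<Rightarrow> real^3^3" where
  "left_inv_field A = (\<lambda>T. if T \<in> H then T ** A else 0)"

definition left_invariant_connection ::
  "((real^3^3 \<Rightarrow> real^3^3) \<Rightarrow> (real^3^3 \<Rightarrow> real^3^3) \<Rightarrow> real^3^3 \<Rightarrow> real^3^3) \<Rightarrow> bool" where
  "left_invariant_connection nabla \<longleftrightarrow>
     (\<forall>S\<in>H. \<forall>X Y. vector_field H hLie X \<longrightarrow> vector_field H hLie Y \<longrightarrow>
        push_connection H H (\<lambda>T. S ** T) nabla X Y = nabla X Y)"

definition is_nabla_H ::
  "((real^3^3 \<Rightarrow> real^3^3) \<Rightarrow> (real^3^3 \<Rightarrow> real^3^3) \<Rightarrow> real^3^3 \<Rightarrow> real^3^3) \<Rightarrow> bool" where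
  "is_nabla_H nabla \<longleftrightarrow>
     affine_connection H hLie nabla \<and> left_invariant_connection nabla \<and>
     (\<forall>A\<in>hLie. \<forall>B\<in>hLie. nabla (left_inv_field A) (left_inv_field B) = (\<lambda>_. 0))"

text \<open>Existence and uniqueness are proved as \<open>ex1_nabla_H\<close> below.\<close>

definition nabla_H ::
  "(real^3^3 \<Rightarrow> real^3^3) \<Rightarrow> (real^3^3 \<Rightarrow> real^3^3) \<Rightarrow> real^3^3 \<Rightarrow> real^3^3" where
  "nabla_H = (THE nabla. is_nabla_H nabla)"

definition nabla_cv ::
  "(real^3^3 \<Rightarrow> real^3^3) \<Rightarrow> (real^3^3 \<Rightarrow> real^3^3) \<Rightarrow> real^3^3 \<Rightarrow> real^3^3" where
  "nabla_cv = push_connection H Omega Phi nabla_H"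


section \<open>Well-definedness of \<open>lower\<close> and \<open>nabla_H\<close>\<close>

lemma vec3_eq_iff: "(A::real^3^3) = B \<longleftrightarrow>
  A$1$1 = B$1$1 \<and> A$1$2 = B$1$2 \<and> A$1$3 = B$1$3 \<and>
  A$2$1 = B$2$1 \<and> A$2$2 = B$2$2 \<and> A$2$3 = B$2$3 \<and>
  A$3$1 = B$3$1 \<and> A$3$2 = B$3$2 \<and> A$3$3 = B$3$3"
  by (auto simp: vec_eq_iff forall_3)

lemma mult3_nth: "((A::real^3^3) ** B)$i$j = A$i$1 * B$1$j + A$i$2 * B$2$j + A$i$3 * B$3$j"
  by (simp add: matrix_matrix_mult_def sum_3)

lemma ex1_lower:
  assumes "u \<in> V"
  shows "\<exists>!A. A \<in> hLie \<and> u = A + transpose A"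
proof -
  obtain x where u: "u = symV x"
    using assms by (auto simp: V_def)
  show ?thesis
  proof (rule ex1I)
    show "vector [vector [x$1/2, 0, 0], vector [0, x$2/2, 0], vector [x$4, x$5, x$3/2]] \<in> hLie \<and>
      u = vector [vector [x$1/2, 0, 0], vector [0, x$2/2, 0], vector [x$4, x$5, x$3/2]]
          + transpose (vector [vector [x$1/2, 0, 0], vector [0, x$2/2, 0], vector [x$4, x$5, x$3/2]])"
      by (simp add: hLie_def u symV_def vec3_eq_iff transpose_def)
  next
    fix A assume "A \<in> hLie \<and> u = A + transpose A"
    then show "A = vector [vector [x$1/2, 0, 0], vector [0, x$2/2, 0], vector [x$4, x$5, x$3/2]]"
      by (auto simp: hLie_def u symV_def vec3_eq_iff transpose_def)
  qed
qed

lemma dir_deriv_eq: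
  assumes f: "(f has_derivative f') (at x within M)"
    and ev: "\<forall>\<^sub>F t in nhds 0. x + t *\<^sub>R u \<in> M"
  shows "dir_deriv f x u = f' u" "(\<lambda>t. f (x + t *\<^sub>R u)) differentiable (at 0)"
proof -
  obtain T where T: "open T" "0 \<in> T" "\<And>t. t \<in> T \<Longrightarrow> x + t *\<^sub>R u \<in> M"
    using ev by (auto simp: eventually_nhds)
  have l: "((\<lambda>t. x + t *\<^sub>R u) has_derivative (\<lambda>t. t *\<^sub>R u)) (at 0 within T)"
    by (auto intro!: derivative_eq_intros)
  have "((\<lambda>t. f (x + t *\<^sub>R u)) has_derivative (\<lambda>t. f' (t *\<^sub>R u))) (at 0 within T)"
    using has_derivative_in_compose[OF l, of f f']
      has_derivative_subset[OF f, of "(\<lambda>t. x + t *\<^sub>R u) ` T"] T(3) by auto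
  hence "((\<lambda>t. f (x + t *\<^sub>R u)) has_derivative (\<lambda>t. f' (t *\<^sub>R u))) (at 0)"
    using T at_within_open by metis
  moreover have "f' (t *\<^sub>R u) = t *\<^sub>R f' u" for t
    using has_derivative_linear[OF f] by (rule linear_scale)
  ultimately have "((\<lambda>t. f (x + t *\<^sub>R u)) has_vector_derivative f' u) (at 0)"
    by (simp add: has_vector_derivative_def)
  then show "dir_deriv f x u = f' u" "(\<lambda>t. f (x + t *\<^sub>R u)) differentiable (at 0)"
    by (auto simp: dir_deriv_def vector_derivative_at intro: differentiableI_vector)
qed

lemma Ck_cong:
  assumes "\<And>x. x \<in> M \<Longrightarrow> f x = g x"
  shows "Ck_on k M E f = Ck_on k M E g"
proof (cases k)
  case 0
  then show ?thesis using assms by (simp cong: continuous_on_cong)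
next
  case (Suc n)
  have "(f has_derivative f') (at x within M) = (g has_derivative f') (at x within M)"
    if "x \<in> M" for x f'
    using assms that by (metis has_derivative_transform)
  then show ?thesis using Suc by simp
qed

lemma Ck_SucD: "Ck_on (Suc k) M E f \<Longrightarrow> Ck_on k M E f"
proof (induction k arbitrary: f)
  case 0
  then show ?case
    by (auto intro: has_derivative_continuous_on)
next
  case (Suc k)
  then obtain f' where "\<forall>x\<in>M. (f has_derivative f' x) (at x within M)"
    "\<forall>u\<in>E. Ck_on (Suc k) M E (\<lambda>x. f' x u)" by (subst (asm) Ck_on.simps(2)) blast
  then show ?case using Suc.IH by auto
qed

lemma Ck_const: "Ck_on k M E (\<lambda>x. c)"
proof (induction k arbitrary: c)
  case (Suc k)
  show ?case
    by (auto intro!: exI[of _ "\<lambda>x u. 0"] derivative_eq_intros Suc)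
qed auto

lemma Ck_linear: "bounded_linear L \<Longrightarrow> Ck_on k M E L"
  by (cases k)
     (auto intro!: exI[of _ "\<lambda>x. L"] bounded_linear_imp_has_derivative Ck_const
           simp: linear_continuous_on)

lemma Ck_add: "Ck_on k M E f \<Longrightarrow> Ck_on k M E g \<Longrightarrow> Ck_on k M E (\<lambda>x. f x + g x)"
proof (induction k arbitrary: f g)
  case 0
  then show ?case by (auto intro: continuous_intros)
next
  case (Suc k)
  then obtain f' g' where "\<forall>x\<in>M. (f has_derivative f' x) (at x within M)"
    "\<forall>u\<in>E. Ck_on k M E (\<lambda>x. f' x u)" "\<forall>x\<in>M. (g has_derivative g' x) (at x within M)"
    "\<forall>u\<in>E. Ck_on k M E (\<lambda>x. g' x u)" by auto
  then show ?case
    by (auto intro!: exI[of _ "\<lambda>x u. f' x u + g' x u"] Suc.IH has_derivative_add)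
qed

lemma Ck_sum:
  "finite I \<Longrightarrow> (\<And>i. i \<in> I \<Longrightarrow> Ck_on k M E (f i)) \<Longrightarrow> Ck_on k M E (\<lambda>x. \<Sum>i\<in>I. f i x)"
  by (induction I rule: finite_induct) (auto intro!: Ck_add Ck_const)

lemma Ck_bilinear:
  assumes B: "bounded_bilinear B"
  shows "Ck_on k M E f \<Longrightarrow> Ck_on k M E g \<Longrightarrow> Ck_on k M E (\<lambda>x. B (f x) (g x))"
proof (induction k arbitrary: f g)
  case 0
  then show ?case by (auto intro: bounded_bilinear.continuous_on[OF B])
next
  case (Suc k)
  then obtain f' g' where *: "\<forall>x\<in>M. (f has_derivative f' x) (at x within M)"
    "\<forall>u\<in>E. Ck_on k M E (\<lambda>x. f' x u)" "\<forall>x\<in>M. (g has_derivative g' x) (at x within M)"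
    "\<forall>u\<in>E. Ck_on k M E (\<lambda>x. g' x u)" by auto
  have "Ck_on k M E f" "Ck_on k M E g" using Suc.prems Ck_SucD by blast+
  then show ?case using *
    by (auto intro!: exI[of _ "\<lambda>x u. B (f x) (g' x u) + B (f' x u) (g x)"] Suc.IH Ck_add
        bounded_bilinear.FDERIV[OF B])
qed

lemma Ck_inverse:
  fixes f :: "'a::real_normed_vector \<Rightarrow> real"
  assumes "\<And>x. x \<in> M \<Longrightarrow> f x \<noteq> 0"
  shows "Ck_on k M E f \<Longrightarrow> Ck_on k M E (\<lambda>x. inverse (f x))"
proof (induction k)
  case 0
  then show ?case using assms by (auto intro!: continuous_on_inverse)
next
  case (Suc k)
  then obtain f' where *: "\<forall>x\<in>M. (f has_derivative f' x) (at x within M)"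
    "\<forall>u\<in>E. Ck_on k M E (\<lambda>x. f' x u)" by auto
  have i: "Ck_on k M E (\<lambda>x. inverse (f x))" using Suc Ck_SucD by blast
  have "Ck_on k M E (\<lambda>x. (-1) * (inverse (f x) * f' x u * inverse (f x)))" if "u \<in> E" for u
    using i *(2) that by (intro Ck_bilinear[OF bounded_bilinear_mult] Ck_const) auto
  then show ?case using * assms
    by (auto intro!: exI[of _ "\<lambda>x u. - (inverse (f x) * f' x u * inverse (f x))"]
        has_derivative_inverse)
qed

lemma Ck_compose_linear:
  assumes L: "bounded_linear L" and LM: "\<And>x. x \<in> M \<Longrightarrow> L x \<in> M'" and LE: "\<And>u. u \<in> E \<Longrightarrow> L u \<in> E'"
  shows "Ck_on k M' E' f \<Longrightarrow> Ck_on k M E (\<lambda>x. f (L x))"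
proof (induction k arbitrary: f)
  case 0
  then show ?case using LM
    using continuous_on_compose2[of M' f M L] linear_continuous_on[OF L, of M] by auto
next
  case (Suc k)
  then obtain f' where *: "\<forall>x\<in>M'. (f has_derivative f' x) (at x within M')"
    "\<forall>u\<in>E'. Ck_on k M' E' (\<lambda>x. f' x u)" by auto
  have "((\<lambda>x. f (L x)) has_derivative (\<lambda>u. f' (L x) (L u))) (at x within M)" if "x \<in> M" for x
    by (rule has_derivative_in_compose2[where t=M'])
       (use * LM that in \<open>auto intro: bounded_linear_imp_has_derivative L\<close>)
  then show ?case using * LE
    by (auto intro!: exI[of _ "\<lambda>x u. f' (L x) (L u)"] Suc.IH)
qed

lemma bounded_bilinear_mm: "bounded_bilinear ((**) :: real^3^3 \<Rightarrow> real^3^3 \<Rightarrow> real^3^3)"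
  unfolding bilinear_conv_bounded_bilinear[symmetric]
  by (auto simp: bilinear_def intro!: linearI simp: vec3_eq_iff mult3_nth algebra_simps)

text \<open>The elementary matrices \<open>hE p\<close>, \<open>p \<in> hI\<close>, form a basis of \<open>hLie\<close>.\<close>

definition hI :: "(3 \<times> 3) set" where "hI = {(1,1), (2,2), (3,1), (3,2), (3,3)}"

definition hE :: "3 \<times> 3 \<Rightarrow> real^3^3" where "hE p = axis (fst p) (axis (snd p) 1)"

lemma finite_hI [simp]: "finite hI" by (simp add: hI_def)

lemma hE_in: "p \<in> hI \<Longrightarrow> hE p \<in> hLie"
  by (auto simp: hI_def hE_def hLie_def axis_def)

lemma hLie_expand:
  assumes "A \<in> hLie"
  shows "A = (\<Sum>p\<in>hI. (A $ fst p $ snd p) *\<^sub>R hE p)"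
  using assms by (simp add: hI_def hE_def hLie_def axis_def vec3_eq_iff)

lemma subspace_hLie: "subspace hLie"
  by (auto simp: subspace_def hLie_def)

lemma H_sub: "T \<in> H \<Longrightarrow> T \<in> hLie" by (simp add: H_def)

lemma H_pos: "T \<in> H \<Longrightarrow> T$1$1 > 0 \<and> T$2$2 > 0 \<and> T$3$3 > 0" by (simp add: H_def)

lemma hLie_mult: "A \<in> hLie \<Longrightarrow> B \<in> hLie \<Longrightarrow> A ** B \<in> hLie"
  by (auto simp: hLie_def mult3_nth)

lemma H_mult: "A \<in> H \<Longrightarrow> B \<in> H \<Longrightarrow> A ** B \<in> H"
  using hLie_mult[of A B] by (auto simp: H_def forall_3) (auto simp: hLie_def mult3_nth)

lemma H_open:
  assumes "T \<in> H" "U \<in> hLie"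
  shows "\<forall>\<^sub>F t in nhds 0. T + t *\<^sub>R U \<in> H"
proof -
  have "((\<lambda>t. (T + t *\<^sub>R U)$i$i) \<longlongrightarrow> (T + 0 *\<^sub>R U)$i$i) (nhds 0)" for i
    by (intro tendsto_intros filterlim_ident)
  then have "\<forall>\<^sub>F t in nhds 0. (T + t *\<^sub>R U)$i$i > 0" for i
    by (rule order_tendstoD) (use assms in \<open>auto simp: H_def\<close>)
  then have "\<forall>\<^sub>F t in nhds 0. \<forall>i. (T + t *\<^sub>R U)$i$i > 0"
    by (simp add: eventually_all_finite)
  then show ?thesis
    by eventually_elim (use assms in \<open>auto simp: H_def hLie_def\<close>)
qed

definition hinv :: "real^3^3 \<Rightarrow> real^3^3" where
  "hinv T = vector [vector [inverse (T$1$1), 0, 0], vector [0, inverse (T$2$2), 0],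
     vector [-(T$3$1 * inverse (T$1$1) * inverse (T$3$3)),
             -(T$3$2 * inverse (T$2$2) * inverse (T$3$3)), inverse (T$3$3)]]"

lemma hinv:
  assumes "T \<in> H"
  shows "hinv T ** T = mat 1" "T ** hinv T = mat 1" "hinv T \<in> H"
  using H_pos[OF assms] H_sub[OF assms]
  by (auto simp: hinv_def hLie_def vec3_eq_iff mult3_nth mat_def H_def forall_3 field_simps)

lemma matrix_inv_eq_hinv: "T \<in> H \<Longrightarrow> matrix_inv T = hinv T"
proof -
  assume T: "T \<in> H"
  have "T ** matrix_inv T = mat 1 \<and> matrix_inv T ** T = mat 1"
    unfolding matrix_inv_def by (rule someI[of _ "hinv T"]) (simp add: hinv[OF T])
  then show ?thesis by (metis hinv(2)[OF T] matrix_mul_assoc matrix_mul_lid matrix_mul_rid)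
qed

lemma Ck_entry: "Ck_on k M E f \<Longrightarrow> Ck_on k M E (\<lambda>x. (f x :: real^3^3) $ i $ j)"
proof -
  assume f: "Ck_on k M E f"
  have "bounded_bilinear (\<lambda>(c::real) (A::real^3^3). c *\<^sub>R (A $ i $ j))"
    unfolding bilinear_conv_bounded_bilinear[symmetric]
    by (auto simp: bilinear_def intro!: linearI simp: algebra_simps)
  from Ck_bilinear[OF this Ck_const f, of 1] show ?thesis by simp
qed

lemma Ck_hLie:
  assumes "\<And>x. x \<in> M \<Longrightarrow> f x \<in> hLie" "\<And>p. p \<in> hI \<Longrightarrow> Ck_on k M E (\<lambda>x. f x $ fst p $ snd p)"
  shows "Ck_on k M E f"
proof -
  have "Ck_on k M E (\<lambda>x. \<Sum>p\<in>hI. (f x $ fst p $ snd p) *\<^sub>R hE p)"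
    using assms by (intro Ck_sum Ck_bilinear[OF bounded_bilinear_scaleR] Ck_const) auto
  then show ?thesis
    using Ck_cong[of M f "\<lambda>x. \<Sum>p\<in>hI. (f x $ fst p $ snd p) *\<^sub>R hE p"] hLie_expand assms(1)
    by blast
qed

lemma Ck_hinv: "Ck_on k H hLie hinv"
proof (rule Ck_hLie)
  show "hinv x \<in> hLie" if "x \<in> H" for x using hinv(3)[OF that] H_sub by blast
  have id: "Ck_on k H hLie (\<lambda>T. T $ i $ j)" for i j
    by (rule Ck_entry, rule Ck_linear) (simp add: bounded_linear_ident)
  have iv: "Ck_on k H hLie (\<lambda>T. inverse (T $ i $ i))" for i
    by (rule Ck_inverse[OF _ id]) (auto simp: H_def dest: spec[of _ i])
  have "Ck_on k H hLie (\<lambda>T. (-1) * (T $ i $ j * inverse (T$j$j) * inverse (T$i$i)))" for i j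
    by (intro Ck_bilinear[OF bounded_bilinear_mult] Ck_const id iv)
  then show "Ck_on k H hLie (\<lambda>T. hinv T $ fst p $ snd p)" if "p \<in> hI" for p
    using that iv by (auto simp: hI_def hinv_def)
qed

lemma smooth_dir_deriv:
  assumes "smooth_on H hLie f" "T \<in> H"
  obtains f' where "(f has_derivative f') (at T within H)" "\<And>u. u \<in> hLie \<Longrightarrow> dir_deriv f T u = f' u"
    "linear f'"
proof -
  have "Ck_on (Suc 0) H hLie f" using assms by (simp add: smooth_on_def)
  then obtain f' where "(f has_derivative f') (at T within H)" using assms by auto
  then show ?thesis
    using that dir_deriv_eq(1)[OF _ H_open[OF assms(2)]] has_derivative_linear[of f f']
    by blast
qed

lemma smooth_deriv_field:
  assumes f: "smooth_on H hLie f" and X: "vector_field H hLie X"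
  shows "smooth_on H hLie (\<lambda>T. dir_deriv f T (X T))"
  unfolding smooth_on_def
proof
  fix k
  obtain f' where *: "\<forall>x\<in>H. (f has_derivative f' x) (at x within H)"
    "\<forall>u\<in>hLie. Ck_on k H hLie (\<lambda>x. f' x u)"
    using f[unfolded smooth_on_def, rule_format, of "Suc k"] by auto
  have "Ck_on k H hLie (\<lambda>T. \<Sum>p\<in>hI. (X T $ fst p $ snd p) *\<^sub>R f' T (hE p))"
    using *(2) hE_in X
    by (intro Ck_sum Ck_bilinear[OF bounded_bilinear_scaleR] Ck_entry)
       (auto simp: vector_field_def smooth_on_def)
  moreover have "dir_deriv f T (X T) = (\<Sum>p\<in>hI. (X T $ fst p $ snd p) *\<^sub>R f' T (hE p))"
    if T: "T \<in> H" for T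
  proof -
    have XT: "X T \<in> hLie" using X T by (auto simp: vector_field_def)
    have "dir_deriv f T (X T) = f' T (X T)"
      using dir_deriv_eq(1) * T H_open XT by blast
    also have "\<dots> = f' T (\<Sum>p\<in>hI. (X T $ fst p $ snd p) *\<^sub>R hE p)"
      using hLie_expand[OF XT] by simp
    also have "\<dots> = (\<Sum>p\<in>hI. (X T $ fst p $ snd p) *\<^sub>R f' T (hE p))"
      using has_derivative_linear[of "f"] * T by (auto simp: linear_sum linear_scale)
    finally show ?thesis .
  qed
  ultimately show "Ck_on k H hLie (\<lambda>T. dir_deriv f T (X T))"
    by (subst Ck_cong) auto
qed

lemma smooth_bilinear:
  "bounded_bilinear B \<Longrightarrow> smooth_on M E f \<Longrightarrow> smooth_on M E g \<Longrightarrow> smooth_on M E (\<lambda>x. B (f x) (g x))"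
  by (simp add: smooth_on_def Ck_bilinear)

lemma smooth_id: "smooth_on M E (\<lambda>x. x)"
  by (simp add: smooth_on_def Ck_linear bounded_linear_ident)

lemma smooth_cong: "(\<And>x. x \<in> M \<Longrightarrow> f x = g x) \<Longrightarrow> smooth_on M E f = smooth_on M E g"
  unfolding smooth_on_def using Ck_cong by blast

text \<open>
  \<open>canon Y\<close> is \<open>Y\<close> in the left trivialisation; the flat connection is
  \<open>nabla_X Y = T D_X (T^(-1) Y)\<close>.
\<close>

definition canon :: "(real^3^3 \<Rightarrow> real^3^3) \<Rightarrow> real^3^3 \<Rightarrow> real^3^3" where
  "canon Y = (\<lambda>S. hinv S ** Y S)"

lemma canon_smooth: "vector_field H hLie Y \<Longrightarrow> smooth_on H hLie (canon Y)"
  unfolding canon_def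
  by (intro smooth_bilinear[OF bounded_bilinear_mm])
     (auto simp: vector_field_def smooth_on_def Ck_hinv)

lemma canon_in: "vector_field H hLie Y \<Longrightarrow> S \<in> H \<Longrightarrow> canon Y S \<in> hLie"
  unfolding canon_def vector_field_def using hinv(3) H_sub hLie_mult by blast

lemma canon_back: "S \<in> H \<Longrightarrow> S ** canon Y S = Y S"
  by (simp add: canon_def matrix_mul_assoc hinv(2))

definition flat :: "(real^3^3 \<Rightarrow> real^3^3) \<Rightarrow> (real^3^3 \<Rightarrow> real^3^3) \<Rightarrow> real^3^3 \<Rightarrow> real^3^3" where
  "flat X Y = (\<lambda>T. if vector_field H hLie X \<and> vector_field H hLie Y \<and> T \<in> H
                    then T ** dir_deriv (canon Y) T (X T) else 0)"

lemma deriv_in_hLie: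
  assumes s: "smooth_on H hLie f" and f: "\<And>S. S \<in> H \<Longrightarrow> f S \<in> hLie" and T: "T \<in> H" and u: "u \<in> hLie"
  shows "dir_deriv f T u \<in> hLie"
proof -
  obtain f' where f': "(f has_derivative f') (at T within H)" using smooth_dir_deriv[OF s T] by metis
  define c where "c t = f (T + t *\<^sub>R u)" for t
  have "c differentiable (at 0)"
    using dir_deriv_eq(2)[OF f' H_open[OF T u]] unfolding c_def .
  then have d: "(c has_vector_derivative dir_deriv f T u) (at 0)"
    unfolding dir_deriv_def c_def by (simp add: vector_derivative_works)
  have ev: "\<forall>\<^sub>F t in nhds 0. c t \<in> hLie"
    using H_open[OF T u] by eventually_elim (simp add: c_def f)
  have "dir_deriv f T u $ i $ j = 0" if ij: "\<And>A. A \<in> hLie \<Longrightarrow> A $ i $ j = 0" for i j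
  proof -
    have bl: "bounded_linear (\<lambda>A::real^3^3. A $ i $ j)"
      by (intro bounded_linear_compose[OF bounded_linear_vec_nth bounded_linear_vec_nth])
    have "((\<lambda>t. c t $ i $ j) has_vector_derivative dir_deriv f T u $ i $ j) (at 0)"
      using bounded_linear.has_vector_derivative[OF bl d] .
    moreover have "\<forall>\<^sub>F t in nhds 0. c t $ i $ j = 0"
      using ev by eventually_elim (simp add: ij)
    ultimately have "((\<lambda>t. 0) has_vector_derivative dir_deriv f T u $ i $ j) (at 0)"
      by (subst (asm) has_vector_derivative_cong_ev[where g="\<lambda>t. 0"])
         (auto elim: eventually_mono dest: eventually_nhds_x_imp_x)
    then show ?thesis
      using vector_derivative_unique_at has_vector_derivative_const by blast
  qed
  then show ?thesis by (auto simp: hLie_def)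
qed

lemma dir_deriv_cong:
  assumes "\<And>S. S \<in> H \<Longrightarrow> f S = g S" "T \<in> H" "u \<in> hLie"
  shows "dir_deriv f T u = dir_deriv g T u"
  unfolding dir_deriv_def
  by (rule vector_derivative_cong_eq)
     (use H_open[OF assms(2,3)] assms(1) in \<open>auto elim: eventually_mono\<close>)

lemma dir_deriv_const [simp]: "dir_deriv (\<lambda>_. c) x u = 0"
  by (simp add: dir_deriv_def)

lemma vf_add: "vector_field H hLie X \<Longrightarrow> vector_field H hLie Y \<Longrightarrow> vector_field H hLie (\<lambda>x. X x + Y x)"
  by (auto simp: vector_field_def smooth_on_def Ck_add subspace_add subspace_hLie)

lemma vf_scale:
  "smooth_on H hLie f \<Longrightarrow> vector_field H hLie X \<Longrightarrow> vector_field H hLie (\<lambda>x. f x *\<^sub>R X x)"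
  by (auto simp: vector_field_def smooth_bilinear[OF bounded_bilinear_scaleR] subspace_scale
      subspace_hLie)

lemma vf_zero: "vector_field H hLie (\<lambda>x. 0)"
  by (simp add: vector_field_def smooth_on_def Ck_const subspace_0 subspace_hLie)

lemma vf_sum:
  "finite I \<Longrightarrow> (\<And>i. i \<in> I \<Longrightarrow> vector_field H hLie (F i)) \<Longrightarrow>
    vector_field H hLie (\<lambda>x. \<Sum>i\<in>I. F i x)"
  by (induction I rule: finite_induct) (auto intro!: vf_add vf_zero)

lemma vf_left_inv: "A \<in> hLie \<Longrightarrow> vector_field H hLie (left_inv_field A)"
proof -
  assume A: "A \<in> hLie"
  have "smooth_on H hLie (\<lambda>T. T ** A)"
    by (rule smooth_bilinear[OF bounded_bilinear_mm smooth_id]) (simp add: smooth_on_def Ck_const)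
  then have "smooth_on H hLie (left_inv_field A)"
    by (subst smooth_cong[where g="\<lambda>T. T ** A"]) (auto simp: left_inv_field_def)
  then show ?thesis
    using A by (auto simp: vector_field_def left_inv_field_def hLie_mult H_sub)
qed

lemma vf_in: "vector_field H hLie X \<Longrightarrow> T \<in> H \<Longrightarrow> X T \<in> hLie"
  by (auto simp: vector_field_def)

lemma vf_out: "vector_field H hLie X \<Longrightarrow> T \<notin> H \<Longrightarrow> X T = 0"
  by (auto simp: vector_field_def)

lemma mm_add_right: "(A::real^3^3) ** (B + C) = A ** B + A ** (C::real^3^3)"
  and mm_scale_right: "(A::real^3^3) ** (c *\<^sub>R (B::real^3^3)) = c *\<^sub>R (A ** B)"
  by (simp_all add: vec3_eq_iff mult3_nth algebra_simps)

lemma dir_deriv_lin: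
  assumes "smooth_on H hLie f" "T \<in> H" "u \<in> hLie" "v \<in> hLie"
  shows "dir_deriv f T (u + v) = dir_deriv f T u + dir_deriv f T v"
    and "dir_deriv f T (c *\<^sub>R u) = c *\<^sub>R dir_deriv f T u"
proof -
  obtain f' where "\<And>u. u \<in> hLie \<Longrightarrow> dir_deriv f T u = f' u" "linear f'"
    using smooth_dir_deriv[OF assms(1,2)] by metis
  then show "dir_deriv f T (u + v) = dir_deriv f T u + dir_deriv f T v"
    "dir_deriv f T (c *\<^sub>R u) = c *\<^sub>R dir_deriv f T u"
    using assms subspace_hLie by (auto simp: linear_add linear_scale subspace_add subspace_scale)
qed

lemma dir_deriv_bilinear:
  assumes B: "bounded_bilinear B" and "smooth_on H hLie f" "smooth_on H hLie g" "T \<in> H" "u \<in> hLie"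
  shows "dir_deriv (\<lambda>S. B (f S) (g S)) T u = B (f T) (dir_deriv g T u) + B (dir_deriv f T u) (g T)"
proof -
  obtain f' where f: "(f has_derivative f') (at T within H)" "dir_deriv f T u = f' u"
    using smooth_dir_deriv[OF assms(2,4)] assms(5) by metis
  obtain g' where g: "(g has_derivative g') (at T within H)" "dir_deriv g T u = g' u"
    using smooth_dir_deriv[OF assms(3,4)] assms(5) by metis
  show ?thesis
    using dir_deriv_eq(1)[OF bounded_bilinear.FDERIV[OF B f(1) g(1)] H_open[OF assms(4,5)]] f g
    by simp
qed

lemma dir_deriv_add:
  assumes "smooth_on H hLie f" "smooth_on H hLie g" "T \<in> H" "u \<in> hLie"
  shows "dir_deriv (\<lambda>S. f S + g S) T u = dir_deriv f T u + dir_deriv g T u"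
proof -
  obtain f' where f: "(f has_derivative f') (at T within H)" "dir_deriv f T u = f' u"
    using smooth_dir_deriv[OF assms(1,3)] assms(4) by metis
  obtain g' where g: "(g has_derivative g') (at T within H)" "dir_deriv g T u = g' u"
    using smooth_dir_deriv[OF assms(2,3)] assms(4) by metis
  show ?thesis
    using dir_deriv_eq(1)[OF has_derivative_add[OF f(1) g(1)] H_open[OF assms(3,4)]] f g
    by simp
qed

lemma flat_affine: "affine_connection H hLie flat"
  unfolding affine_connection_def
proof (intro conjI allI impI)
  fix X Y
  assume XY: "vector_field H hLie X" "vector_field H hLie Y"
  let ?D = "\<lambda>T. T ** dir_deriv (canon Y) T (X T)"
  have "smooth_on H hLie ?D"
    using XY by (intro smooth_bilinear[OF bounded_bilinear_mm smooth_id] smooth_deriv_field canon_smooth)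
  then have "smooth_on H hLie (flat X Y)"
    by (subst smooth_cong[where g="?D"]) (auto simp: flat_def XY)
  moreover have "flat X Y T \<in> hLie" if "T \<in> H" for T
    using XY that unfolding flat_def
    by (simp add: hLie_mult H_sub deriv_in_hLie canon_smooth canon_in vf_in)
  ultimately show "vector_field H hLie (flat X Y)"
    by (auto simp: vector_field_def flat_def)
next
  fix X X' Y
  assume "vector_field H hLie X" "vector_field H hLie X'" "vector_field H hLie Y"
  then show "flat (\<lambda>x. X x + X' x) Y = (\<lambda>x. flat X Y x + flat X' Y x)"
    by (auto simp: flat_def vf_add dir_deriv_lin(1) canon_smooth vf_in mm_add_right)
next
  fix f :: "real^3^3 \<Rightarrow> real" and X Y
  assume *: "smooth_on H hLie f" "vector_field H hLie X" "vector_field H hLie Y"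
  show "flat (\<lambda>x. f x *\<^sub>R X x) Y = (\<lambda>x. f x *\<^sub>R flat X Y x)"
    using * vf_scale[OF *(1,2)]
    by (auto simp: flat_def mm_scale_right dir_deriv_lin(2)[OF canon_smooth _ _ vf_in] vf_in)
next
  fix X Y Y'
  assume *: "vector_field H hLie X" "vector_field H hLie Y" "vector_field H hLie Y'"
  have c: "canon (\<lambda>x. Y x + Y' x) = (\<lambda>x. canon Y x + canon Y' x)"
    by (auto simp: canon_def mm_add_right)
  show "flat X (\<lambda>x. Y x + Y' x) = (\<lambda>x. flat X Y x + flat X Y' x)"
    using * vf_add[OF *(2,3)]
    by (auto simp: flat_def c dir_deriv_add canon_smooth vf_in mm_add_right)
next
  fix f :: "real^3^3 \<Rightarrow> real" and X Y
  assume *: "smooth_on H hLie f" "vector_field H hLie X" "vector_field H hLie Y"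
  have c: "canon (\<lambda>x. f x *\<^sub>R Y x) = (\<lambda>x. f x *\<^sub>R canon Y x)"
    by (auto simp: canon_def mm_scale_right)
  show "flat X (\<lambda>x. f x *\<^sub>R Y x) =
          (\<lambda>x. f x *\<^sub>R flat X Y x + dir_deriv f x (X x) *\<^sub>R Y x)"
    using * vf_scale[OF *(1,3)]
    by (auto simp: fun_eq_iff flat_def c dir_deriv_bilinear[OF bounded_bilinear_scaleR] canon_smooth
        vf_in vf_out mm_add_right mm_scale_right canon_back)
qed (auto simp: flat_def)

lemma inv_left_mult:
  assumes "S \<in> H" "R \<in> H"
  shows "inv_into H (\<lambda>T. S ** T) R = hinv S ** R"
proof (rule inv_into_f_eq)
  show "inj_on (\<lambda>T. S ** T) H"
    by (rule inj_on_inverseI[where g="\<lambda>T. hinv S ** T"]) (simp add: matrix_mul_assoc hinv(1)[OF assms(1)])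
  show "hinv S ** R \<in> H" by (simp add: H_mult hinv(3) assms)
  show "S ** (hinv S ** R) = R" by (simp add: matrix_mul_assoc hinv(2)[OF assms(1)])
qed

lemma bounded_linear_lmult: "bounded_linear (\<lambda>T::real^3^3. (S::real^3^3) ** T)"
  by (rule bounded_bilinear.bounded_linear_right[OF bounded_bilinear_mm])

lemma dir_deriv_lmult:
  fixes S :: "real^3^3"
  assumes "T \<in> H" "u \<in> hLie"
  shows "dir_deriv (\<lambda>T. S ** T) T u = S ** u"
  by (rule dir_deriv_eq(1)[OF bounded_linear_imp_has_derivative[OF bounded_linear_lmult] H_open[OF assms]])

lemma pull_lmult:
  assumes "S \<in> H" "vector_field H hLie Y"
  shows "pull_field H (\<lambda>T. S ** T) Y = (\<lambda>T. if T \<in> H then hinv S ** Y (S ** T) else 0)"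
proof
  fix T
  show "pull_field H (\<lambda>T. S ** T) Y T = (if T \<in> H then hinv S ** Y (S ** T) else 0)"
  proof (cases "T \<in> H")
    case True
    then have "S ** T \<in> H" using assms H_mult by blast
    then have "dir_deriv (inv_into H (\<lambda>T. S ** T)) (S ** T) (Y (S ** T)) = hinv S ** Y (S ** T)"
      using dir_deriv_cong[of "inv_into H (\<lambda>T. S ** T)" "\<lambda>R. hinv S ** R" "S ** T" "Y (S ** T)"]
        inv_left_mult[OF assms(1)] dir_deriv_lmult[of "S ** T" "Y (S ** T)" "hinv S"]
        vf_in[OF assms(2)] by simp
    then show ?thesis using True by (simp add: pull_field_def)
  qed (simp add: pull_field_def)
qed

lemma smooth_comp_lmult:
  assumes "S \<in> H" "smooth_on H hLie f"
  shows "smooth_on H hLie (\<lambda>T. f (S ** T))"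
  unfolding smooth_on_def
proof
  fix k
  show "Ck_on k H hLie (\<lambda>T. f (S ** T))"
    by (rule Ck_compose_linear[OF bounded_linear_lmult, where M'=H and E'=hLie])
       (use assms H_mult hLie_mult H_sub in \<open>auto simp: smooth_on_def\<close>)
qed

lemma vf_pull_lmult:
  assumes "S \<in> H" "vector_field H hLie Y"
  shows "vector_field H hLie (pull_field H (\<lambda>T. S ** T) Y)"
proof -
  have "smooth_on H hLie (\<lambda>T. hinv S ** Y (S ** T))"
  proof (rule smooth_bilinear[OF bounded_bilinear_mm])
    show "smooth_on H hLie (\<lambda>_. hinv S)" by (simp add: smooth_on_def Ck_const)
    show "smooth_on H hLie (\<lambda>T. Y (S ** T))"
      using assms by (auto simp: vector_field_def intro: smooth_comp_lmult)
  qed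
  then have "smooth_on H hLie (pull_field H (\<lambda>T. S ** T) Y)"
    by (subst smooth_cong[where g="\<lambda>T. hinv S ** Y (S ** T)"]) (auto simp: pull_lmult[OF assms])
  moreover have "hinv S ** Y (S ** T) \<in> hLie" if "T \<in> H" for T
    using hLie_mult H_sub hinv(3) H_mult vf_in assms that by metis
  ultimately show ?thesis
    by (simp add: vector_field_def pull_lmult[OF assms])
qed

lemma hinv_mult:
  assumes "S \<in> H" "T \<in> H"
  shows "hinv (S ** T) = hinv T ** hinv S"
proof -
  have "hinv (S ** T) ** (S ** T) ** hinv T ** hinv S = hinv T ** hinv S"
    using hinv(1)[OF H_mult[OF assms]] by simp
  moreover have "(S ** T) ** hinv T ** hinv S = mat 1"
    by (metis assms hinv(2) matrix_mul_assoc matrix_mul_rid)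
  ultimately show ?thesis by (metis matrix_mul_assoc matrix_mul_rid)
qed

lemma flat_left_invariant: "left_invariant_connection flat"
  unfolding left_invariant_connection_def
proof (intro ballI allI impI ext)
  fix S X Y R
  assume S: "S \<in> H" and X: "vector_field H hLie X" and Y: "vector_field H hLie Y"
  let ?L = "\<lambda>T. S ** T"
  show "push_connection H H ?L flat X Y R = flat X Y R"
  proof (cases "R \<in> H")
    case True
    let ?T = "hinv S ** R"
    have T: "?T \<in> H" using S True H_mult hinv(3) by blast
    have ST: "S ** ?T = R" by (simp add: matrix_mul_assoc hinv(2)[OF S])
    have c: "canon (pull_field H ?L Y) T = canon Y (S ** T)" if "T \<in> H" for T
      using that by (simp add: canon_def pull_lmult[OF S Y] hinv_mult[OF S] matrix_mul_assoc)
    obtain f' where f: "(canon Y has_derivative f') (at R within H)"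
      "\<And>u. u \<in> hLie \<Longrightarrow> dir_deriv (canon Y) R u = f' u"
      using smooth_dir_deriv[OF canon_smooth[OF Y] True] by metis
    have "((\<lambda>T. canon Y (S ** T)) has_derivative (\<lambda>u. f' (S ** u))) (at ?T within H)"
    proof (rule has_derivative_in_compose[where f="(**) S" and f'="(**) S" and g="canon Y" and g'=f'])
      show "((**) S has_derivative (**) S) (at ?T within H)"
        by (rule bounded_linear_imp_has_derivative[OF bounded_linear_lmult])
      show "(canon Y has_derivative f') (at (S ** ?T) within (**) S ` H)"
        unfolding ST by (rule has_derivative_subset[OF f(1)]) (use S H_mult in auto)
    qed
    then have d: "dir_deriv (\<lambda>T. canon Y (S ** T)) ?T u = f' (S ** u)" if "u \<in> hLie" for u
      using dir_deriv_eq(1) H_open[OF T that] by blast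
    have u: "hinv S ** X R \<in> hLie"
      using hLie_mult H_sub hinv(3)[OF S] vf_in[OF X True] by blast
    have "dir_deriv (canon (pull_field H ?L Y)) ?T (hinv S ** X R) = f' (S ** (hinv S ** X R))"
      using dir_deriv_cong[OF c T u] d[OF u] by simp
    also have "\<dots> = dir_deriv (canon Y) R (X R)"
      using f(2)[OF vf_in[OF X True]] by (simp add: matrix_mul_assoc hinv(2)[OF S])
    finally have e: "flat (pull_field H ?L X) (pull_field H ?L Y) ?T
        = ?T ** dir_deriv (canon Y) R (X R)"
      using T S X Y by (simp add: flat_def vf_pull_lmult) (simp add: pull_lmult ST)
    have "?T ** dir_deriv (canon Y) R (X R) \<in> hLie"
      by (intro hLie_mult[OF H_sub[OF T]] deriv_in_hLie[OF canon_smooth[OF Y] canon_in[OF Y] True vf_in[OF X True]])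
    then show ?thesis
      using True X Y unfolding push_connection_def push_field_def
      by (simp add: inv_left_mult[OF S] e dir_deriv_lmult[OF T] matrix_mul_assoc)
         (simp add: flat_def hinv(2)[OF S])
  qed (simp add: push_connection_def push_field_def flat_def)
qed

lemma is_nabla_H_flat: "is_nabla_H flat"
proof -
  have "flat (left_inv_field A) (left_inv_field B) T = 0" if "A \<in> hLie" "B \<in> hLie" for A B T
  proof (cases "T \<in> H")
    case True
    have "canon (left_inv_field B) S = B" if "S \<in> H" for S
      using that by (simp add: canon_def left_inv_field_def matrix_mul_assoc hinv(1))
    then have "dir_deriv (canon (left_inv_field B)) T (left_inv_field A T) = 0"
      using dir_deriv_cong[of "canon (left_inv_field B)" "\<lambda>_. B", OF _ True]
        vf_in[OF vf_left_inv[OF \<open>A \<in> hLie\<close>] True] by simp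
    then show ?thesis by (simp add: flat_def)
  qed (simp add: flat_def)
  then show ?thesis
    using flat_affine flat_left_invariant by (auto simp: is_nabla_H_def)
qed

lemma vf_expand:
  assumes "vector_field H hLie Y"
  shows "Y = (\<lambda>T. \<Sum>p\<in>hI. (canon Y T $ fst p $ snd p) *\<^sub>R left_inv_field (hE p) T)"
proof
  fix T
  show "Y T = (\<Sum>p\<in>hI. (canon Y T $ fst p $ snd p) *\<^sub>R left_inv_field (hE p) T)"
  proof (cases "T \<in> H")
    case True
    have "Y T = T ** (\<Sum>p\<in>hI. (canon Y T $ fst p $ snd p) *\<^sub>R hE p)"
      using hLie_expand[OF canon_in[OF assms True]] canon_back[OF True] by metis
    also have "\<dots> = (\<Sum>p\<in>hI. T ** ((canon Y T $ fst p $ snd p) *\<^sub>R hE p))"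
      using linear_sum bounded_linear.linear[OF bounded_linear_lmult] by blast
    finally show ?thesis using True by (simp add: left_inv_field_def mm_scale_right)
  qed (simp add: left_inv_field_def vf_out[OF assms])
qed

lemma smooth_canon_entry:
  "vector_field H hLie Y \<Longrightarrow> smooth_on H hLie (\<lambda>T. canon Y T $ i $ j)"
  using canon_smooth by (auto simp: smooth_on_def Ck_entry)

lemma connection_scale_left:
  fixes f :: "real^3^3 \<Rightarrow> real"
  assumes "affine_connection H hLie n" "smooth_on H hLie f" "vector_field H hLie X"
    "vector_field H hLie Y"
  shows "n (\<lambda>x. f x *\<^sub>R X x) Y = (\<lambda>x. f x *\<^sub>R n X Y x)"
  using assms(1)[unfolded affine_connection_def, THEN conjunct2, THEN conjunct2, THEN conjunct2,
      THEN conjunct1, rule_format, OF assms(2-4)] .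

lemma connection_scale_right:
  fixes f :: "real^3^3 \<Rightarrow> real"
  assumes "affine_connection H hLie n" "smooth_on H hLie f" "vector_field H hLie X"
    "vector_field H hLie Y"
  shows "n X (\<lambda>x. f x *\<^sub>R Y x) =
    (\<lambda>x. f x *\<^sub>R n X Y x + dir_deriv f x (X x) *\<^sub>R Y x)"
  using assms(1)[unfolded affine_connection_def, THEN conjunct2, THEN conjunct2, THEN conjunct2,
      THEN conjunct2, THEN conjunct2, rule_format, OF assms(2-4)] .

lemma connection_sum_right:
  assumes n: "affine_connection H hLie n" and X: "vector_field H hLie X"
  shows "finite I \<Longrightarrow> (\<And>i. i \<in> I \<Longrightarrow> vector_field H hLie (F i)) \<Longrightarrow>
    n X (\<lambda>x. \<Sum>i\<in>I. F i x) = (\<lambda>x. \<Sum>i\<in>I. n X (F i) x)"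
proof (induction I rule: finite_induct)
  case empty
  have "smooth_on H hLie (\<lambda>_. 0::real)" by (simp add: smooth_on_def Ck_const)
  moreover have "\<forall>f X Y. smooth_on H hLie (f :: real^3^3 \<Rightarrow> real) \<longrightarrow> vector_field H hLie X \<longrightarrow>
      vector_field H hLie Y \<longrightarrow> n X (\<lambda>x. f x *\<^sub>R Y x) =
          (\<lambda>x. f x *\<^sub>R n X Y x + dir_deriv f x (X x) *\<^sub>R Y x)"
    using n unfolding affine_connection_def by blast
  ultimately have "n X (\<lambda>x. 0 *\<^sub>R X x) = (\<lambda>x. 0 *\<^sub>R n X X x + dir_deriv (\<lambda>_. 0::real) x (X x) *\<^sub>R X x)"
    using X by blast
  then show ?case by simp
next
  case (insert i I)
  have "n X (\<lambda>x. F i x + (\<Sum>i\<in>I. F i x)) = (\<lambda>x. n X (F i) x + n X (\<lambda>x. \<Sum>i\<in>I. F i x) x)"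
    using n X insert vf_sum[of I F] unfolding affine_connection_def by simp
  then show ?case using insert by simp
qed

lemma connection_sum_left:
  assumes n: "affine_connection H hLie n" and Y: "vector_field H hLie Y"
  shows "finite I \<Longrightarrow> (\<And>i. i \<in> I \<Longrightarrow> vector_field H hLie (F i)) \<Longrightarrow>
    n (\<lambda>x. \<Sum>i\<in>I. F i x) Y = (\<lambda>x. \<Sum>i\<in>I. n (F i) Y x)"
proof (induction I rule: finite_induct)
  case empty
  have "smooth_on H hLie (\<lambda>_. 0::real)" by (simp add: smooth_on_def Ck_const)
  moreover have "\<forall>f X Y. smooth_on H hLie (f :: real^3^3 \<Rightarrow> real) \<longrightarrow> vector_field H hLie X \<longrightarrow>
      vector_field H hLie Y \<longrightarrow> n (\<lambda>x. f x *\<^sub>R X x) Y = (\<lambda>x. f x *\<^sub>R n X Y x)"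
    using n unfolding affine_connection_def by blast
  ultimately have "n (\<lambda>x. 0 *\<^sub>R Y x) Y = (\<lambda>x. 0 *\<^sub>R n Y Y x)"
    using Y by blast
  then show ?case by simp
next
  case (insert i I)
  have "n (\<lambda>x. F i x + (\<Sum>i\<in>I. F i x)) Y = (\<lambda>x. n (F i) Y x + n (\<lambda>x. \<Sum>i\<in>I. F i x) Y x)"
    using n Y insert vf_sum[of I F] unfolding affine_connection_def by simp
  then show ?case using insert by simp
qed

lemma is_nabla_H_formula:
  assumes n: "is_nabla_H n" and X: "vector_field H hLie X" and Y: "vector_field H hLie Y"
  shows "n X Y = (\<lambda>T. \<Sum>p\<in>hI. dir_deriv (\<lambda>S. canon Y S $ fst p $ snd p) T (X T) *\<^sub>R
                                 left_inv_field (hE p) T)"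
proof -
  let ?E = "\<lambda>p. left_inv_field (hE p)"
  let ?c = "\<lambda>Y p T. canon Y T $ fst p $ snd p"
  have a: "affine_connection H hLie n" using n by (simp add: is_nabla_H_def)
  have E: "vector_field H hLie (?E p)" if "p \<in> hI" for p using that hE_in vf_left_inv by blast
  have z: "n X (?E p) = (\<lambda>_. 0)" if p: "p \<in> hI" for p
  proof -
    have "n (\<lambda>T. \<Sum>q\<in>hI. ?c X q T *\<^sub>R ?E q T) (?E p) = (\<lambda>T. \<Sum>q\<in>hI. n (\<lambda>T. ?c X q T *\<^sub>R ?E q T) (?E p) T)"
      by (rule connection_sum_left[OF a E[OF p] finite_hI])
         (erule vf_scale[OF smooth_canon_entry[OF X] E])
    also have "\<dots> = (\<lambda>T. \<Sum>q\<in>hI. ?c X q T *\<^sub>R n (?E q) (?E p) T)"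
    proof -
      have "n (\<lambda>T. ?c X q T *\<^sub>R ?E q T) (?E p) = (\<lambda>T. ?c X q T *\<^sub>R n (?E q) (?E p) T)"
        if "q \<in> hI" for q
        by (rule connection_scale_left[OF a smooth_canon_entry[OF X] E[OF that] E[OF p]])
      then show ?thesis by simp
    qed
    also have "\<dots> = (\<lambda>_. 0)"
      using n hE_in p by (simp add: is_nabla_H_def)
    finally show ?thesis unfolding vf_expand[OF X, symmetric] .
  qed
  have "n X (\<lambda>T. \<Sum>p\<in>hI. ?c Y p T *\<^sub>R ?E p T) = (\<lambda>T. \<Sum>p\<in>hI. n X (\<lambda>T. ?c Y p T *\<^sub>R ?E p T) T)"
    by (rule connection_sum_right[OF a X finite_hI])
       (erule vf_scale[OF smooth_canon_entry[OF Y] E])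
  also have "\<dots> = (\<lambda>T. \<Sum>p\<in>hI. dir_deriv (?c Y p) T (X T) *\<^sub>R ?E p T)"
  proof -
    have "n X (\<lambda>T. ?c Y p T *\<^sub>R ?E p T) =
        (\<lambda>T. ?c Y p T *\<^sub>R n X (?E p) T + dir_deriv (?c Y p) T (X T) *\<^sub>R ?E p T)"
      if "p \<in> hI" for p
      by (rule connection_scale_right[OF a smooth_canon_entry[OF Y] X E[OF that]])
    then show ?thesis using z by simp
  qed
  finally show ?thesis unfolding vf_expand[OF Y, symmetric] .
qed

theorem ex1_nabla_H: "\<exists>!nabla. is_nabla_H nabla"
proof (rule ex1I[of is_nabla_H flat, OF is_nabla_H_flat], intro ext)
  fix n X Y T
  assume n: "is_nabla_H n"
  show "n X Y T = flat X Y T"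
  proof (cases "vector_field H hLie X \<and> vector_field H hLie Y")
    case True
    then show ?thesis
      using is_nabla_H_formula[OF n] is_nabla_H_formula[OF is_nabla_H_flat] by simp
  next
    case False
    then have "n X Y = (\<lambda>_. 0)"
      using n unfolding is_nabla_H_def affine_connection_def by blast
    then show ?thesis using False by (auto simp: flat_def)
  qed
qed

corollary nabla_H_eq: "nabla_H = flat"
  unfolding nabla_H_def by (rule the1_equality[of is_nabla_H flat, OF ex1_nabla_H is_nabla_H_flat])

end

theory Submission
  imports Defs
begin

text \<open>
  In the left trivialisation \<open>U = T A\<close>, the differential of \<open>Phi\<close> sends \<open>T A\<close> to
  \<open>T (A + A\<^sup>T) T\<^sup>T\<close>, so both metrics become one fixed bilinear form on \<open>hLie\<close>: for \<open>g_can\<close> the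
  factors \<open>T\<close> cancel inside the trace, and for \<open>g_H\<close> the form comes from the trace of the clan
  multiplication.  The connection is plain differentiation in the left trivialisation, so a form with
  constant coefficients is parallel by the product rule.  The Cholesky factor inverts \<open>Phi\<close>
  explicitly; its derivative is found by differentiating \<open>Phi (chol x) = x\<close>.
\<close>

section \<open>The space of symmetric matrices and the clan trace form\<close>


lemma V_iff: "u \<in> V \<longleftrightarrow> u$1$2 = 0 \<and> u$2$1 = 0 \<and> u$1$3 = u$3$1 \<and> u$2$3 = u$3$2"
proof
  assume r: "u$1$2 = 0 \<and> u$2$1 = 0 \<and> u$1$3 = u$3$1 \<and> u$2$3 = u$3$2"
  define x :: "real^5" where
    "x = (\<chi> i. if i = 1 then u$1$1 else if i = 2 then u$2$2 else if i = 3 then u$3$3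
               else if i = 4 then u$3$1 else u$3$2)"
  have "u = symV x" using r by (simp add: symV_def x_def vec3_eq_iff)
  then show "u \<in> V" by (simp add: V_def)
qed (auto simp: V_def symV_def)

lemma subspace_V: "subspace V"
  by (simp add: subspace_def V_iff)

text \<open>Closed form of \<open>lower\<close> on \<open>V\<close>. It is total and linear on all
  matrices, so it can be composed with smooth maps, while the definite description says nothing
  outside \<open>V\<close>.\<close>

definition low :: "real^3^3 \<Rightarrow> real^3^3" where
  "low u = vector [vector [u$1$1/2, 0, 0], vector [0, u$2$2/2, 0],
                   vector [u$3$1, u$3$2, u$3$3/2]]"

lemma low_hLie: "low u \<in> hLie"
  by (simp add: low_def hLie_def)

lemma low_eqI: "A \<in> hLie \<Longrightarrow> low (A + transpose A) = A"
  by (simp add: low_def hLie_def vec3_eq_iff transpose_def)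

lemma low_decomp: "u \<in> V \<Longrightarrow> low u + transpose (low u) = u"
  by (simp add: low_def V_iff vec3_eq_iff transpose_def)

lemma lower_eq_low: "u \<in> V \<Longrightarrow> lower u = low u"
  unfolding lower_def using ex1_lower low_hLie low_decomp by (intro the1_equality) auto

lemma bounded_linear_low: "bounded_linear low"
  unfolding linear_conv_bounded_linear[symmetric]
  by (auto intro!: linearI simp: low_def vec3_eq_iff add_divide_distrib)

section \<open>Traces of left multiplications in the clan\<close>

lemma UNIV_5: "(UNIV :: 5 set) = {1, 2, 3, 4, 5}"
proof -
  have "card {1, 2, 3, 4, 5 :: 5} = 5" by simp
  then show ?thesis by (intro card_subset_eq[symmetric]) auto
qed

lemma sum_5: "sum f (UNIV :: 5 set) = f 1 + f 2 + f 3 + f 4 + f 5"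
  unfolding UNIV_5 by (simp add: add.assoc)

lemma inv_symV:
  assumes "M \<in> V"
  shows "inv symV M $ 1 = M$1$1" "inv symV M $ 2 = M$2$2" "inv symV M $ 3 = M$3$3"
    "inv symV M $ 4 = M$3$1" "inv symV M $ 5 = M$3$2"
proof -
  have "symV (inv symV M) = M" using assms by (simp add: V_def f_inv_into_f)
  then show "inv symV M $ 1 = M$1$1" "inv symV M $ 2 = M$2$2" "inv symV M $ 3 = M$3$3"
    "inv symV M $ 4 = M$3$1" "inv symV M $ 5 = M$3$2"
    by (auto simp: symV_def vec3_eq_iff)
qed

lemma hLie_conj_V: "A \<in> hLie \<Longrightarrow> w \<in> V \<Longrightarrow> A ** w + w ** transpose A \<in> V"
  by (simp add: hLie_def V_iff mult3_nth transpose_def algebra_simps)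

text \<open>Left multiplication by \<open>u\<close> has diagonal coefficients \<open>u$1$1\<close>,
  \<open>u$2$2\<close>, \<open>u$3$3\<close> on the diagonal coordinates, and
  \<open>(u$1$1 + u$3$3)/2\<close> and \<open>(u$2$2 + u$3$3)/2\<close> on coordinates 4 and
  5.\<close>

lemma trace_V_clan:
  assumes "u \<in> V"
  shows "trace_V (clan u) = (3 * u$1$1 + 3 * u$2$2 + 4 * u$3$3) / 2"
proof -
  have V: "low u ** symV x + symV x ** transpose (low u) \<in> V" for x
    by (intro hLie_conj_V low_hLie) (simp add: V_def)
  let ?f = "\<lambda>x. low u ** symV x + symV x ** transpose (low u)"
  have "trace_V (clan u) = (\<Sum>i\<in>UNIV. inv symV (?f (axis i 1)) $ i)"
    by (simp add: trace_V_def trace_def matrix_def clan_def lower_eq_low[OF assms])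
  also have "\<dots> = ?f (axis 1 1) $ 1 $ 1 + ?f (axis 2 1) $ 2 $ 2 + ?f (axis 3 1) $ 3 $ 3
      + ?f (axis 4 1) $ 3 $ 1 + ?f (axis 5 1) $ 3 $ 2"
    unfolding sum_5 inv_symV[OF V] ..
  also have "\<dots> = (3 * u$1$1 + 3 * u$2$2 + 4 * u$3$3) / 2"
    unfolding vector_add_component mult3_nth low_def symV_def transpose_def
    by (simp add: axis_def)
  finally show ?thesis .
qed

text \<open>The common coordinate form of both metrics in the left trivialisation. Being bilinear on
  all matrices, it falls under the product rule for \<open>dir_deriv\<close>.\<close>

definition qh :: "real^3^3 \<Rightarrow> real^3^3 \<Rightarrow> real" where
  "qh A B = 6 * A$1$1 * B$1$1 + 6 * A$2$2 * B$2$2 + 8 * A$3$3 * B$3$3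
     + 4 * A$3$1 * B$3$1 + 4 * A$3$2 * B$3$2"

lemma bounded_bilinear_qh: "bounded_bilinear qh"
  unfolding bilinear_conv_bounded_bilinear[symmetric]
  by (auto simp: bilinear_def qh_def intro!: linearI simp: algebra_simps)

lemma hLie_sym_V: "A \<in> hLie \<Longrightarrow> A + transpose A \<in> V"
  by (simp add: hLie_def V_iff transpose_def)

lemma Q_h_eq_qh:
  assumes "A \<in> hLie" "B \<in> hLie"
  shows "Q_h A B = qh A B"
proof -
  note A = hLie_sym_V[OF assms(1)] and B = hLie_sym_V[OF assms(2)]
  have c: "clan (A + transpose A) (B + transpose B)
      = A ** (B + transpose B) + (B + transpose B) ** transpose A"
    by (simp add: clan_def lower_eq_low[OF A] low_eqI[OF assms(1)])
  show ?thesis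
    unfolding Q_h_def Q_clan_def c trace_V_clan[OF hLie_conj_V[OF assms(1) B]]
    using assms by (simp add: mult3_nth transpose_def qh_def hLie_def field_simps)
qed

section \<open>Cholesky factorization on the cone\<close>

text \<open>On \<open>V\<close> this is the Schur complement of the leading 2 by 2 block, which is
  diagonal there; for \<open>x = Phi T\<close> it is the square of \<open>T$3$3\<close>.\<close>

definition schur :: "real^3^3 \<Rightarrow> real" where
  "schur x = x$3$3 - (x$3$1)\<^sup>2 / x$1$1 - (x$3$2)\<^sup>2 / x$2$2"

definition chol :: "real^3^3 \<Rightarrow> real^3^3" where
  "chol x = vector [vector [sqrt (x$1$1), 0, 0], vector [0, sqrt (x$2$2), 0],
     vector [x$3$1 / sqrt (x$1$1), x$3$2 / sqrt (x$2$2), sqrt (schur x)]]"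

lemma Omega_posD:
  assumes "x \<in> Omega"
  shows "x$1$1 > 0" "x$2$2 > 0" "schur x > 0"
proof -
  have V: "x \<in> V" and p: "\<And>w. w \<noteq> 0 \<Longrightarrow> w \<bullet> (x *v w) > 0"
    using assms by (auto simp: Omega_def)
  show 1: "x$1$1 > 0" using p[of "axis 1 1"]
    by (simp add: inner_vec_def sum_3 matrix_vector_mult_def axis_def vec_eq_iff forall_3)
  show 2: "x$2$2 > 0" using p[of "axis 2 1"]
    by (simp add: inner_vec_def sum_3 matrix_vector_mult_def axis_def vec_eq_iff forall_3)
  \<comment> \<open>This vector minimises the quadratic form among vectors with last entry 1, and
    the minimum is the Schur complement.\<close>
  show "schur x > 0" using p[of "vector [- x$3$1 / x$1$1, - x$3$2 / x$2$2, 1]"] V 1 2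
    by (simp add: inner_vec_def sum_3 matrix_vector_mult_def vec_eq_iff forall_3 V_iff schur_def
        power2_eq_square)
qed

lemma chol_H: "0 < x$1$1 \<Longrightarrow> 0 < x$2$2 \<Longrightarrow> 0 < schur x \<Longrightarrow> chol x \<in> H"
  by (simp add: chol_def H_def hLie_def forall_3)

lemma Phi_chol:
  assumes "x \<in> V" "0 < x$1$1" "0 < x$2$2" "0 < schur x"
  shows "Phi (chol x) = x"
proof -
  have "sqrt (schur x) * sqrt (schur x) = schur x" using assms by simp
  then show ?thesis
    using assms by (simp add: Phi_def chol_def vec3_eq_iff mult3_nth transpose_def V_iff)
      (simp add: schur_def power2_eq_square)
qed

lemma chol_Phi:
  assumes "T \<in> H"
  shows "chol (Phi T) = T"
proof -
  have z: "T$1$2 = 0" "T$1$3 = 0" "T$2$3 = 0" "T$2$1 = 0" and p: "T$1$1 > 0" "T$2$2 > 0" "T$3$3 > 0"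
    using H_pos[OF assms] H_sub[OF assms] by (auto simp: hLie_def)
  have e: "Phi T $ 1 $ 1 = (T$1$1)\<^sup>2" "Phi T $ 2 $ 2 = (T$2$2)\<^sup>2"
    "Phi T $ 3 $ 1 = T$3$1 * T$1$1" "Phi T $ 3 $ 2 = T$3$2 * T$2$2"
    "Phi T $ 3 $ 3 = (T$3$1)\<^sup>2 + (T$3$2)\<^sup>2 + (T$3$3)\<^sup>2"
    by (simp_all add: Phi_def mult3_nth transpose_def power2_eq_square z)
  have "schur (Phi T) = (T$3$3)\<^sup>2"
    unfolding schur_def e using p by (simp add: power_mult_distrib)
  then show ?thesis
    using p z by (simp add: chol_def e vec3_eq_iff)
qed

lemma Phi_Omega:
  assumes T: "T \<in> H"
  shows "Phi T \<in> Omega"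
proof -
  have "w \<bullet> (Phi T *v w) > 0" if "w \<noteq> 0" for w
  proof -
    have e: "w \<bullet> (Phi T *v w) = (transpose T *v w) \<bullet> (transpose T *v w)"
      by (simp add: Phi_def dot_lmul_matrix matrix_vector_mul_assoc[symmetric])
    \<comment> \<open>The form is a squared norm, so only injectivity of \<open>transpose T\<close>
      remains; a left inverse provides it.\<close>
    have "transpose (hinv T) *v (transpose T *v w) = w"
      by (metis T hinv(2) matrix_transpose_mul matrix_vector_mul_assoc matrix_vector_mul_lid transpose_mat)
    then have "transpose T *v w \<noteq> 0" using that by force
    then show ?thesis unfolding e by simp
  qed
  moreover have "Phi T \<in> V"
    using H_sub[OF T] by (simp add: V_iff Phi_def mult3_nth transpose_def hLie_def algebra_simps)
  ultimately show ?thesis by (simp add: Omega_def)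
qed

text \<open>The three inequalities make \<open>chol x\<close> an element of \<open>H\<close>, so
  \<open>x = Phi (chol x)\<close> is positive definite without expanding its quadratic form.\<close>

lemma Omega_iff: "x \<in> Omega \<longleftrightarrow> x \<in> V \<and> 0 < x$1$1 \<and> 0 < x$2$2 \<and> 0 < schur x"
proof
  assume "x \<in> Omega" then show "x \<in> V \<and> 0 < x$1$1 \<and> 0 < x$2$2 \<and> 0 < schur x"
    using Omega_posD by (auto simp: Omega_def)
next
  assume "x \<in> V \<and> 0 < x$1$1 \<and> 0 < x$2$2 \<and> 0 < schur x"
  then show "x \<in> Omega" using Phi_Omega[OF chol_H, of x] Phi_chol[of x] by simp
qed

lemma chol:
  assumes "x \<in> Omega"
  shows "chol x \<in> H" "Phi (chol x) = x"
  using assms chol_H Phi_chol by (auto simp: Omega_iff)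

lemma inv_Phi: "x \<in> Omega \<Longrightarrow> inv_into H Phi x = chol x"
  by (rule inv_into_f_eq) (auto intro: inj_on_inverseI[where g=chol] simp: chol chol_Phi)

text \<open>Along a line in \<open>V\<close> the three strict inequalities of
  \<open>Omega_iff\<close> persist by continuity. This is the hypothesis under which
  \<open>dir_deriv\<close> agrees with a derivative within \<open>Omega\<close>.\<close>

lemma Omega_open:
  assumes x: "x \<in> Omega" and u: "u \<in> V"
  shows "\<forall>\<^sub>F t in nhds 0. x + t *\<^sub>R u \<in> Omega"
proof -
  let ?c = "\<lambda>t::real. x + t *\<^sub>R u"
  note p = Omega_posD[OF x]
  have e: "((\<lambda>t. ?c t $ i $ j) \<longlongrightarrow> x $ i $ j) (nhds 0)" for i j
  proof -
    have "((\<lambda>t. ?c t $ i $ j) \<longlongrightarrow> (x + 0 *\<^sub>R u) $ i $ j) (nhds 0)"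
      by (intro tendsto_intros filterlim_ident)
    then show ?thesis by simp
  qed
  have "((\<lambda>t. schur (?c t)) \<longlongrightarrow> schur x) (nhds 0)"
    unfolding schur_def by (intro tendsto_diff tendsto_divide tendsto_power e) (use p in auto)
  then have "\<forall>\<^sub>F t in nhds 0. ?c t $ 1 $ 1 > 0" "\<forall>\<^sub>F t in nhds 0. ?c t $ 2 $ 2 > 0"
    "\<forall>\<^sub>F t in nhds 0. schur (?c t) > 0"
    using e order_tendstoD(1) p by blast+
  then show ?thesis
  proof eventually_elim
    case (elim t)
    have "?c t \<in> V" using x u subspace_V by (simp add: Omega_iff subspace_add subspace_scale)
    then show ?case using elim by (simp add: Omega_iff)
  qed
qed

section \<open>Differentials of the Cholesky diffeomorphism\<close>

definition dPhi :: "real^3^3 \<Rightarrow> real^3^3 \<Rightarrow> real^3^3" where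
  "dPhi T U = U ** transpose T + T ** transpose U"

lemma bounded_linear_transpose: "bounded_linear (transpose :: real^3^3 \<Rightarrow> real^3^3)"
  unfolding linear_conv_bounded_linear[symmetric]
  by (auto intro!: linearI simp: transpose_def vec3_eq_iff)

lemma Phi_has_derivative: "(Phi has_derivative dPhi T) (at T within M)"
  unfolding Phi_def[abs_def] dPhi_def[abs_def] add.commute[of "_ ** transpose T"]
  by (rule bounded_bilinear.FDERIV[OF bounded_bilinear_mm])
     (auto intro!: bounded_linear_imp_has_derivative bounded_linear_transpose)

lemma dir_deriv_Phi: "dir_deriv Phi T u = dPhi T u"
  by (rule dir_deriv_eq(1)[OF Phi_has_derivative[of T UNIV]]) simp

lemma dPhi_left: "dPhi T (T ** A) = T ** (A + transpose A) ** transpose T"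
  by (simp add: dPhi_def matrix_transpose_mul matrix_add_ldistrib
      matrix_mul_assoc bounded_bilinear.add_left[OF bounded_bilinear_mm])

lemma dPhi_V: "T \<in> hLie \<Longrightarrow> U \<in> hLie \<Longrightarrow> dPhi T U \<in> V"
  by (simp add: hLie_def V_iff mult3_nth transpose_def dPhi_def algebra_simps)

lemma dir_deriv_cong_on:
  assumes "\<forall>\<^sub>F t in nhds 0. x + t *\<^sub>R u \<in> M" "\<And>y. y \<in> M \<Longrightarrow> f y = g y"
  shows "dir_deriv f x u = dir_deriv g x u"
  unfolding dir_deriv_def
  by (rule vector_derivative_cong_eq) (use assms in \<open>auto elim: eventually_mono\<close>)

text \<open>The \<open>A \<in> hLie\<close> with \<open>dPhi T (T ** A) = u\<close>.\<close>

definition ltriv :: "real^3^3 \<Rightarrow> real^3^3 \<Rightarrow> real^3^3" where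
  "ltriv T u = low (hinv T ** u ** transpose (hinv T))"

lemma ltriv_hLie: "ltriv T u \<in> hLie"
  by (simp add: ltriv_def low_hLie)

lemma conj_V: "T \<in> hLie \<Longrightarrow> u \<in> V \<Longrightarrow> T ** u ** transpose T \<in> V"
  by (simp add: hLie_def V_iff mult3_nth transpose_def algebra_simps)

lemma hinv_transpose:
  assumes "T \<in> H"
  shows "transpose (hinv T) ** transpose T = mat 1" "transpose T ** transpose (hinv T) = mat 1"
  by (simp_all add: matrix_transpose_mul[symmetric] hinv[OF assms] transpose_mat)

lemma hinv_conj_cancel:
  assumes "T \<in> H"
  shows "hinv T ** (T ** u ** transpose T) ** transpose (hinv T) = u"
    "T ** (hinv T ** u ** transpose (hinv T)) ** transpose T = u"
proof -
  have "hinv T ** (T ** u ** transpose T) ** transpose (hinv T)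
      = (hinv T ** T) ** u ** (transpose T ** transpose (hinv T))"
    by (simp only: matrix_mul_assoc)
  then show "hinv T ** (T ** u ** transpose T) ** transpose (hinv T) = u"
    by (simp add: hinv[OF assms] hinv_transpose[OF assms])
  have "T ** (hinv T ** u ** transpose (hinv T)) ** transpose T
      = (T ** hinv T) ** u ** (transpose (hinv T) ** transpose T)"
    by (simp only: matrix_mul_assoc)
  then show "T ** (hinv T ** u ** transpose (hinv T)) ** transpose T = u"
    by (simp add: hinv[OF assms] hinv_transpose[OF assms])
qed

lemma ltriv_dPhi: "T \<in> H \<Longrightarrow> A \<in> hLie \<Longrightarrow> ltriv T (dPhi T (T ** A)) = A"
  by (simp add: ltriv_def dPhi_left hinv_conj_cancel low_eqI)

lemma dPhi_ltriv:
  assumes "T \<in> H" "u \<in> V"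
  shows "dPhi T (T ** ltriv T u) = u"
  unfolding dPhi_left ltriv_def low_decomp[OF conj_V[OF H_sub[OF hinv(3)[OF assms(1)]] assms(2)]]
  by (rule hinv_conj_cancel(2)[OF assms(1)])

section \<open>Derivative of the Cholesky factor\<close>

lemma differentiable_real_sqrt:
  fixes f :: "'a::real_normed_vector \<Rightarrow> real"
  shows "f differentiable (at x within M) \<Longrightarrow> 0 < f x \<Longrightarrow> (\<lambda>x. sqrt (f x)) differentiable (at x within M)"
  unfolding differentiable_def using has_derivative_real_sqrt by blast

lemma chol_hLie: "chol x \<in> hLie"
  by (simp add: chol_def hLie_def)

text \<open>Only existence is established here, entry by entry, since the radicands and denominators
  are positive at \<open>x\<close>. The value follows from the inverse relation with
  \<open>Phi\<close>.\<close>

lemma chol_differentiable: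
  assumes "x \<in> Omega"
  shows "chol differentiable (at x within M)"
proof -
  note p = Omega_posD[OF assms]
  have e: "(\<lambda>x. x $ i $ j) differentiable (at x within M)" for i j :: 3
    by (intro bounded_linear_imp_differentiable bounded_linear_compose[OF bounded_linear_vec_nth]
        bounded_linear_vec_nth)
  have s: "schur differentiable (at x within M)"
    unfolding schur_def[abs_def] using p
    by (intro differentiable_diff differentiable_divide differentiable_power e) auto
  have "(\<lambda>x. chol x $ fst q $ snd q) differentiable (at x within M)" if "q \<in> hI" for q
    using that p unfolding chol_def
    by (auto simp: hI_def intro!: differentiable_real_sqrt differentiable_divide e s)
  then have "(\<lambda>x. \<Sum>q\<in>hI. (chol x $ fst q $ snd q) *\<^sub>R hE q) differentiable (at x within M)"
    by (intro differentiable_sum differentiable_scaleR differentiable_const finite_hI) auto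
  then show ?thesis using hLie_expand[OF chol_hLie] by simp
qed

lemma chol_derivative:
  assumes T: "T \<in> H"
  obtains c' where "(chol has_derivative c') (at (Phi T) within Omega)"
    "\<And>u. u \<in> V \<Longrightarrow> c' u = T ** ltriv T u"
proof -
  note x = Phi_Omega[OF T]
  obtain c' where c: "(chol has_derivative c') (at (Phi T) within Omega)"
    using chol_differentiable[OF x] by (auto simp: differentiable_def)
  have "c' u = T ** ltriv T u" if u: "u \<in> V" for u
  proof -
    have e: "c' u $ i $ j = dir_deriv (\<lambda>y. chol y $ i $ j) (Phi T) u" for i j
      using dir_deriv_eq(1)[OF bounded_linear.has_derivative[OF bounded_linear_vec_nth
          bounded_linear.has_derivative[OF bounded_linear_vec_nth c]] Omega_open[OF x u]]
      by simp
    \<comment> \<open>The entries of \<open>chol\<close> that must vanish are constantly 0, hence so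
      are their derivatives.\<close>
    have U: "c' u \<in> hLie"
      using chol_hLie by (simp add: hLie_def e)
    define A where "A = hinv T ** c' u"
    have A: "A \<in> hLie" "T ** A = c' u"
      using hLie_mult[OF H_sub[OF hinv(3)[OF T]] U]
      by (auto simp: A_def matrix_mul_assoc hinv(2)[OF T])
    have "((\<lambda>y. Phi (chol y)) has_derivative (\<lambda>u. dPhi T (c' u))) (at (Phi T) within Omega)"
      using has_derivative_compose[OF c Phi_has_derivative] by (simp add: chol_Phi[OF T])
    from dir_deriv_eq(1)[OF this Omega_open[OF x u]]
    have "dPhi T (c' u) = dir_deriv (\<lambda>y. Phi (chol y)) (Phi T) u" by simp
    also have "\<dots> = dir_deriv (\<lambda>y. y) (Phi T) u"
      by (rule dir_deriv_cong_on[OF Omega_open[OF x u]]) (simp add: chol)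
    also have "\<dots> = u"
      by (rule dir_deriv_eq(1)[OF has_derivative_ident Omega_open[OF x u]])
    \<comment> \<open>Applying \<open>ltriv T\<close> to \<open>dPhi T (T ** A) = u\<close> recovers
      \<open>A\<close>.\<close>
    finally have "ltriv T u = A" using ltriv_dPhi[OF T A(1)] A(2) by simp
    then show ?thesis using A(2) by simp
  qed
  then show ?thesis using that c by blast
qed

lemma dir_deriv_inv_Phi:
  assumes T: "T \<in> H" and u: "u \<in> V"
  shows "dir_deriv (inv_into H Phi) (Phi T) u = T ** ltriv T u"
proof -
  obtain c' where c: "(chol has_derivative c') (at (Phi T) within Omega)" "c' u = T ** ltriv T u"
    using chol_derivative[OF T] u by metis
  note o = Omega_open[OF Phi_Omega[OF T] u]
  show ?thesis
    using dir_deriv_cong_on[OF o inv_Phi] dir_deriv_eq(1)[OF c(1) o] c(2) by simp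
qed

section \<open>Comparison of the metrics\<close>

lemma matrix_inv_eqI:
  fixes A B :: "real^'n^'n"
  assumes "A ** B = mat 1" "B ** A = mat 1"
  shows "matrix_inv A = B"
proof -
  have "A ** matrix_inv A = mat 1 \<and> matrix_inv A ** A = mat 1"
    unfolding matrix_inv_def by (rule someI[of _ B]) (simp add: assms)
  then show ?thesis by (metis assms(2) matrix_mul_assoc matrix_mul_lid matrix_mul_rid)
qed

text \<open>Cyclicity reduces the trace term to \<open>2 * trace (?a ** ?b)\<close>, with
  coefficients 8, 8, 8 on the diagonal and 4, 4 below it. The correction term subtracts 2 from the
  first two, giving the 6, 6, 8, 4, 4 of \<open>qh\<close>.\<close>

lemma g_can_Phi:
  assumes T: "T \<in> H" and A: "A \<in> hLie" and B: "B \<in> hLie"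
  shows "g_can (Phi T) (dPhi T (T ** A)) (dPhi T (T ** B)) = qh A B"
proof -
  let ?P = "transpose (hinv T) ** hinv T" and ?a = "A + transpose A" and ?b = "B + transpose B"
  have PT: "Phi T ** ?P = T ** (transpose T ** transpose (hinv T)) ** hinv T"
    "?P ** Phi T = transpose (hinv T) ** (hinv T ** T) ** transpose T"
    by (simp_all only: matrix_mul_assoc Phi_def)
  have inv: "matrix_inv (Phi T) = ?P"
    by (rule matrix_inv_eqI) (simp_all add: PT hinv[OF T] hinv_transpose[OF T])
  have c: "?P ** (T ** c ** transpose T) = transpose (hinv T) ** c ** transpose T" for c
  proof -
    have "?P ** (T ** c ** transpose T) = transpose (hinv T) ** (hinv T ** T) ** c ** transpose T"
      by (simp only: matrix_mul_assoc)
    then show ?thesis by (simp add: hinv[OF T])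
  qed
  have "?P ** (T ** ?a ** transpose T) ** ?P ** (T ** ?b ** transpose T)
      = (?P ** (T ** ?a ** transpose T)) ** (?P ** (T ** ?b ** transpose T))"
    by (simp only: matrix_mul_assoc)
  also have "\<dots> = transpose (hinv T) ** ?a ** (transpose T ** transpose (hinv T)) ** ?b ** transpose T"
    unfolding c by (simp only: matrix_mul_assoc)
  also have "\<dots> = transpose (hinv T) ** (?a ** ?b ** transpose T)"
    by (simp add: hinv_transpose[OF T] matrix_mul_assoc)
  finally have "trace (?P ** (T ** ?a ** transpose T) ** ?P ** (T ** ?b ** transpose T))
      = trace (?a ** ?b ** transpose T ** transpose (hinv T))"
    using trace_mul_sym by metis
  also have "?a ** ?b ** transpose T ** transpose (hinv T) = ?a ** ?b"
    by (simp add: matrix_mul_assoc[symmetric] hinv_transpose[OF T])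
  finally have tr: "trace (?P ** (T ** ?a ** transpose T) ** ?P ** (T ** ?b ** transpose T))
      = trace (?a ** ?b)" .
  \<comment> \<open>The first two rows of \<open>T\<close> have only their diagonal entries, so
    conjugation merely rescales these two entries and the factors \<open>T$i$i\<close> cancel in the
    correction term.\<close>
  have d: "(T ** (C + transpose C) ** transpose T) $ 1 $ 1 = 2 * C$1$1 * (T$1$1)\<^sup>2"
    "(T ** (C + transpose C) ** transpose T) $ 2 $ 2 = 2 * C$2$2 * (T$2$2)\<^sup>2"
    "Phi T $ 1 $ 1 = (T$1$1)\<^sup>2" "Phi T $ 2 $ 2 = (T$2$2)\<^sup>2" for C
    using H_sub[OF T]
    by (simp_all add: mult3_nth transpose_def Phi_def hLie_def power2_eq_square)
  show ?thesis
    unfolding g_can_def dPhi_left inv tr d using H_pos[OF T] A B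
    by (simp add: trace_def sum_3 mult3_nth transpose_def hLie_def qh_def)
      (simp add: field_simps power4_eq_xxxx power2_eq_square)
qed

lemma pull_metric_eq:
  assumes T: "T \<in> H" and "U \<in> hLie" "W \<in> hLie"
  shows "pull_metric Phi g_can T U W = g_H T U W"
proof -
  have m: "hinv T ** R \<in> hLie" "T ** (hinv T ** R) = R" if "R \<in> hLie" for R
    using hLie_mult[OF H_sub[OF hinv(3)[OF T]] that]
    by (auto simp: matrix_mul_assoc hinv(2)[OF T])
  show ?thesis
    using g_can_Phi[OF T m(1) m(1), OF assms(2,3)] m assms
    by (simp add: pull_metric_def dir_deriv_Phi g_H_def matrix_inv_eq_hinv Q_h_eq_qh)
qed

text \<open>Pushing forward is pulling back along \<open>chol\<close>; at \<open>T = chol x\<close>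
  the vectors \<open>T ** ltriv T u\<close> are the preimages of \<open>u\<close> under
  \<open>dPhi T\<close>, so the equality on \<open>H\<close> carries over.\<close>

lemma g_cv_eq:
  assumes "x \<in> Omega" "u \<in> V" "v \<in> V"
  shows "g_cv x u v = g_can x u v"
proof -
  define T where "T = chol x"
  have T: "T \<in> H" "x = Phi T" using chol[OF assms(1)] by (auto simp: T_def)
  have "g_cv x u v = g_H T (T ** ltriv T u) (T ** ltriv T v)"
    using assms T by (simp add: g_cv_def push_metric_def pull_metric_def dir_deriv_inv_Phi
        inv_Phi chol_Phi)
  also have "\<dots> = pull_metric Phi g_can T (T ** ltriv T u) (T ** ltriv T v)"
    using pull_metric_eq[OF T(1)] hLie_mult[OF H_sub[OF T(1)] ltriv_hLie] by simp
  finally show ?thesis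
    using assms T by (simp add: pull_metric_def dir_deriv_Phi dPhi_ltriv)
qed

section \<open>The pushed-forward connection\<close>

text \<open>The halved diagonal of \<open>low v\<close> compensates for the doubled diagonal of
  \<open>hE p + transpose (hE p)\<close>.\<close>

lemma V_expand:
  assumes "v \<in> V"
  shows "v = (\<Sum>p\<in>hI. (low v $ fst p $ snd p) *\<^sub>R (hE p + transpose (hE p)))"
proof -
  have "transpose (low v) = (\<Sum>p\<in>hI. transpose ((low v $ fst p $ snd p) *\<^sub>R hE p))"
    using hLie_expand[OF low_hLie, of v] linear_sum[OF bounded_linear.linear[OF bounded_linear_transpose]]
    by metis
  then have "low v + transpose (low v) = (\<Sum>p\<in>hI. (low v $ fst p $ snd p) *\<^sub>R hE p)
      + (\<Sum>p\<in>hI. (low v $ fst p $ snd p) *\<^sub>R transpose (hE p))"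
    using hLie_expand[OF low_hLie, of v]
    by (simp add: linear_scale[OF bounded_linear.linear[OF bounded_linear_transpose]])
  then show ?thesis
    using low_decomp[OF assms] by (simp add: scaleR_add_right sum.distrib)
qed

text \<open>
  The derivative of \<open>f \<circ> Phi\<close> evaluates \<open>f'\<close> in a direction that moves with \<open>T\<close>; expanding it in a
  fixed basis of \<open>V\<close> reduces to the constant directions over which \<^const>\<open>Ck_on\<close> recurses.
\<close>

lemma Ck_compose_Phi: "Ck_on k Omega V f \<Longrightarrow> Ck_on k H hLie (\<lambda>T. f (Phi T))"
proof (induction k arbitrary: f)
  case 0
  have "continuous_on H Phi"
    using Phi_has_derivative by (rule has_derivative_continuous_on)
  then show ?case
    using 0 continuous_on_compose2[of Omega f H Phi] Phi_Omega by auto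
next
  case (Suc k)
  let ?v = "\<lambda>p. hE p + transpose (hE p)"
  obtain f' where f: "\<And>x. x \<in> Omega \<Longrightarrow> (f has_derivative f' x) (at x within Omega)"
    "\<And>u. u \<in> V \<Longrightarrow> Ck_on k Omega V (\<lambda>x. f' x u)" using Suc.prems by auto
  have "((\<lambda>T. f (Phi T)) has_derivative (\<lambda>U. f' (Phi T) (dPhi T U))) (at T within H)"
    if "T \<in> H" for T
    by (rule has_derivative_in_compose2[where t=Omega, OF f(1)])
       (use Phi_Omega Phi_has_derivative that in auto)
  moreover have "Ck_on k H hLie (\<lambda>T. f' (Phi T) (dPhi T U))" if U: "U \<in> hLie" for U
  proof -
    \<comment> \<open>For fixed \<open>U\<close> the direction is linear in \<open>T\<close>, so its
      coefficients are differentiable to every order; the induction hypothesis covers the remaining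
      factor \<open>f' (Phi T) (?v p)\<close>.\<close>
    have "bounded_linear (\<lambda>T. dPhi T U)"
      unfolding dPhi_def
      by (intro bounded_linear_add bounded_bilinear.bounded_linear_left[OF bounded_bilinear_mm]
          bounded_linear_compose[OF bounded_bilinear.bounded_linear_right[OF bounded_bilinear_mm]
            bounded_linear_transpose])
    then have "Ck_on k H hLie (\<lambda>T. low (dPhi T U) $ i $ j)" for i j
      by (intro Ck_entry Ck_linear bounded_linear_compose[OF bounded_linear_low])
    then have "Ck_on k H hLie (\<lambda>T. \<Sum>p\<in>hI. (low (dPhi T U) $ fst p $ snd p) *\<^sub>R f' (Phi T) (?v p))"
      using f(2)[OF hLie_sym_V[OF hE_in]]
      by (intro Ck_sum Ck_bilinear[OF bounded_bilinear_scaleR] Suc.IH) auto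
    moreover have "f' (Phi T) (dPhi T U)
        = (\<Sum>p\<in>hI. (low (dPhi T U) $ fst p $ snd p) *\<^sub>R f' (Phi T) (?v p))" if "T \<in> H" for T
    proof -
      have l: "linear (f' (Phi T))" using has_derivative_linear f(1) Phi_Omega that by blast
      have "f' (Phi T) (dPhi T U)
          = f' (Phi T) (\<Sum>p\<in>hI. (low (dPhi T U) $ fst p $ snd p) *\<^sub>R ?v p)"
        using V_expand[OF dPhi_V[OF H_sub[OF that] U]] by simp
      then show ?thesis by (simp add: linear_sum[OF l] linear_scale[OF l])
    qed
    ultimately show ?thesis by (subst Ck_cong) auto
  qed
  ultimately show ?case by (auto intro!: exI[of _ "\<lambda>T U. f' (Phi T) (dPhi T U)"])
qed

lemma smooth_linear:
  fixes L :: "'b::real_normed_vector \<Rightarrow> 'c::real_normed_vector"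
  assumes "bounded_linear L" "smooth_on M E f"
  shows "smooth_on M E (\<lambda>x. L (f x))"
proof -
  \<comment> \<open>The linear map is seen as the bilinear map \<open>c *\<^sub>R L y\<close> at the
    constant \<open>c = 1\<close>.\<close>
  have "smooth_on M E (\<lambda>x. (1::real) *\<^sub>R L (f x))"
    by (rule smooth_bilinear[OF bounded_bilinear.comp[OF bounded_bilinear_scaleR bounded_linear_ident assms(1)] _ assms(2)])
       (simp add: smooth_on_def Ck_const)
  then show ?thesis by simp
qed

section \<open>Fields and connection transported along \<open>Phi\<close>\<close>

lemma pull_Phi:
  assumes "vector_field Omega V Y" "T \<in> H"
  shows "pull_field H Phi Y T = T ** ltriv T (Y (Phi T))"
  using assms Phi_Omega by (simp add: pull_field_def vector_field_def dir_deriv_inv_Phi)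

lemma vf_pull_Phi:
  assumes Y: "vector_field Omega V Y"
  shows "vector_field H hLie (pull_field H Phi Y)"
proof -
  have h: "smooth_on H hLie hinv" by (simp add: smooth_on_def Ck_hinv)
  have "smooth_on H hLie (\<lambda>T. Y (Phi T))"
    using Y by (simp add: vector_field_def smooth_on_def Ck_compose_Phi)
  then have "smooth_on H hLie (\<lambda>T. T ** ltriv T (Y (Phi T)))"
    unfolding ltriv_def
    by (intro smooth_bilinear[OF bounded_bilinear_mm] smooth_linear[OF bounded_linear_low]
        smooth_linear[OF bounded_linear_transpose] smooth_id h)
  then have "smooth_on H hLie (pull_field H Phi Y)"
    by (subst smooth_cong[where g="\<lambda>T. T ** ltriv T (Y (Phi T))"]) (auto simp: pull_Phi[OF Y])
  then show ?thesis
    by (auto simp: vector_field_def pull_Phi[OF Y] hLie_mult[OF H_sub ltriv_hLie])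
       (simp add: pull_field_def)
qed

lemma nabla_cv_eq:
  assumes X: "vector_field Omega V X" and Y: "vector_field Omega V Y" and T: "T \<in> H"
  shows "nabla_cv X Y (Phi T) =
    dPhi T (T ** dir_deriv (canon (pull_field H Phi Y)) T (T ** ltriv T (X (Phi T))))"
  using T by (simp add: nabla_cv_def nabla_H_eq push_connection_def push_field_def Phi_Omega
      inv_Phi chol_Phi dir_deriv_Phi flat_def vf_pull_Phi[OF X] vf_pull_Phi[OF Y] pull_Phi[OF X T])

lemma metric_parallel_g_can: "metric_parallel Omega V nabla_cv g_can"
  unfolding metric_parallel_def
proof (intro allI impI ballI)
  fix X Y Z x
  assume X: "vector_field Omega V X" and Y: "vector_field Omega V Y"
    and Z: "vector_field Omega V Z" and x: "x \<in> Omega"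
  define T where "T = chol x"
  define a where "a = canon (pull_field H Phi Y)"
  define b where "b = canon (pull_field H Phi Z)"
  \<comment> \<open>The function \<open>g_can (Y, Z)\<close> read on \<open>H\<close>; all its
    dependence on \<open>S\<close> sits in \<open>a\<close> and \<open>b\<close>.\<close>
  define K where "K S = qh (a S) (b S)" for S
  \<comment> \<open>The tangent vector at \<open>T\<close> that \<open>dPhi T\<close> sends to
    \<open>X x\<close>.\<close>
  define U where "U = T ** ltriv T (X x)"
  have T: "T \<in> H" and xT: "Phi T = x" using chol[OF x] by (auto simp: T_def)
  have XV: "X x \<in> V" using X x by (simp add: vector_field_def)
  have U: "U \<in> hLie" by (simp add: U_def hLie_mult H_sub T ltriv_hLie)
  have sa: "smooth_on H hLie a" and sb: "smooth_on H hLie b"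
    using canon_smooth vf_pull_Phi Y Z by (auto simp: a_def b_def)
  have aH: "a S \<in> hLie" and bH: "b S \<in> hLie" if "S \<in> H" for S
    using canon_in vf_pull_Phi Y Z that by (auto simp: a_def b_def)
  have Ya: "dPhi S (S ** a S) = Y (Phi S)" and Zb: "dPhi S (S ** b S) = Z (Phi S)" if "S \<in> H" for S
    using that Y Z Phi_Omega[OF that]
    by (auto simp: a_def b_def canon_back pull_Phi dPhi_ltriv vector_field_def)
  have g: "g_can y (Y y) (Z y) = K (chol y)" if "y \<in> Omega" for y
    using g_can_Phi[OF chol(1) aH[OF chol(1)] bH[OF chol(1)], OF that that that]
      Ya[OF chol(1)] Zb[OF chol(1)] chol(2) that by (simp add: K_def)
  have sK: "smooth_on H hLie K"
    unfolding K_def[abs_def] by (rule smooth_bilinear[OF bounded_bilinear_qh sa sb])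
  obtain K' where K: "(K has_derivative K') (at T within H)" "dir_deriv K T U = K' U"
    using smooth_dir_deriv[OF sK T] U by metis
  obtain c' where c: "(chol has_derivative c') (at x within Omega)" "c' (X x) = U"
    using chol_derivative[OF T] XV unfolding xT U_def by metis
  note o = Omega_open[OF x XV]
  have "(K has_derivative K') (at (chol x) within chol ` Omega)"
    using K(1) chol(1) unfolding T_def by (blast intro: has_derivative_subset)
  then have "((\<lambda>y. K (chol y)) has_derivative (\<lambda>u. K' (c' u))) (at x within Omega)"
    using has_derivative_in_compose[OF c(1)] by blast
  from dir_deriv_eq(1)[OF this o] c(2) have "dir_deriv (\<lambda>y. K (chol y)) x (X x) = K' U"
    by simp
  then have "dir_deriv (\<lambda>y. g_can y (Y y) (Z y)) x (X x) = dir_deriv K T U"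
    using dir_deriv_cong_on[OF o g] K(2) by simp
  \<comment> \<open>The coefficients of \<open>qh\<close> are constant, so the product rule yields
    just two terms; these are the two connection terms of the covariant derivative.\<close>
  also have "\<dots> = qh (a T) (dir_deriv b T U) + qh (dir_deriv a T U) (b T)"
    unfolding K_def[abs_def] by (rule dir_deriv_bilinear[OF bounded_bilinear_qh sa sb T U])
  also have "qh (a T) (dir_deriv b T U) = g_can x (Y x) (nabla_cv X Z x)"
    using g_can_Phi[OF T aH[OF T] deriv_in_hLie[OF sb bH T U]] nabla_cv_eq[OF X Z T] Ya[OF T]
    by (simp add: xT U_def b_def)
  also have "qh (dir_deriv a T U) (b T) = g_can x (nabla_cv X Y x) (Z x)"
    using g_can_Phi[OF T deriv_in_hLie[OF sa aH T U] bH[OF T]] nabla_cv_eq[OF X Y T] Zb[OF T]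
    by (simp add: xT U_def a_def)
  finally show "cov_deriv_metric nabla_cv g_can X Y Z x = 0"
    by (simp add: cov_deriv_metric_def)
qed

theorem proposition6p8:
  shows "(\<forall>T\<in>H. \<forall>U\<in>hLie. \<forall>W\<in>hLie. pull_metric Phi g_can T U W = g_H T U W) \<and>
         (\<forall>x\<in>Omega. \<forall>u\<in>V. \<forall>v\<in>V. g_cv x u v = g_can x u v) \<and>
         metric_parallel Omega V nabla_cv g_can"
  using pull_metric_eq g_cv_eq metric_parallel_g_can by blast

end
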